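(* Let $\ell_0$ be an oriented line in $\mathbb{R}^3$ and let $\mathcal{F}$ be a finite family of constraints (for $\ell_0$) that minimally pins $\ell_0$. Then $|\mathcal{F}|\le 8$. If moreover no two lines of $\mathcal{F}$ are simultaneously coplanar and concurrent with $\ell_0$ (i.e. no two of them both pass through the same point of $\ell_0$ and lie in a common plane containing $\ell_0$), then $|\mathcal{F}|\le 6$.
   Context: All lines are oriented. For two non-parallel oriented lines $\ell_1,\ell_2$ with direction vectors $d_1,d_2$, $\ell_2$ passes to the right of $\ell_1$ if $\ell_2$ can be translated by a positive multiple of $d_1\times d_2$ so as to meet $\ell_1$, and to the left of $\ell_1$ if it can be translated by a negative multiple of $d_1\times d_2$ to meet $\ell_1$. Given the fixed oriented line $\ell_0$, a constraint is an oriented line meeting $\ell_0$ in exactly one point. An oriented line $\ell$ satisfies a constraint $g$ if $\ell$ meets $g$ or passes to the right of $g$. A family $\mathcal{F}$ of constraints pins $\ell_0$ if there is a neighborhood of $\ell_0$ in the space of oriented lines such that $\ell_0$ is the only line in this neighborhood satisfying all constraints of $\mathcal{F}$ (equivalently, every other line in the neighborhood passes to the left of some line of $\mathcal{F}$). $\mathcal{F}$ is a minimal pinning if it pins $\ell_0$ and no proper subfamily does. *)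

theory Defs
  imports "HOL-Analysis.Analysis"
begin

text \<open>An oriented line in R^3 is represented by a pair (p, d) of a point p on the line
  and a nonzero direction vector d.  Two pairs represent the same oriented line iff
  they have the same point set and positively proportional directions.\<close>

type_synonym oline = "(real^3) \<times> (real^3)"

definition is_line :: "oline \<Rightarrow> bool" where
  "is_line l \<longleftrightarrow> snd l \<noteq> 0"

definition on_line :: "real^3 \<Rightarrow> oline \<Rightarrow> bool" where
  "on_line x l \<longleftrightarrow> (\<exists>s::real. x = fst l + s *\<^sub>R snd l)"

definition same_oline :: "oline \<Rightarrow> oline \<Rightarrow> bool" where
  "same_oline l m \<longleftrightarrow> on_line (fst m) l \<and> (\<exists>c::real. c > 0 \<and> snd m = c *\<^sub>R snd l)"

definition meets :: "oline \<Rightarrow> oline \<Rightarrow> bool" where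
  "meets l m \<longleftrightarrow> (\<exists>x. on_line x l \<and> on_line x m)"

definition parallel :: "oline \<Rightarrow> oline \<Rightarrow> bool" where
  "parallel l m \<longleftrightarrow> cross3 (snd l) (snd m) = 0"

definition translate :: "real^3 \<Rightarrow> oline \<Rightarrow> oline" where
  "translate v l = (fst l + v, snd l)"

definition passes_right :: "oline \<Rightarrow> oline \<Rightarrow> bool" where
  "passes_right l2 l1 \<longleftrightarrow> \<not> parallel l1 l2 \<and>
     (\<exists>t::real. t > 0 \<and> meets (translate (t *\<^sub>R cross3 (snd l1) (snd l2)) l2) l1)"

definition passes_left :: "oline \<Rightarrow> oline \<Rightarrow> bool" where
  "passes_left l2 l1 \<longleftrightarrow> \<not> parallel l1 l2 \<and>
     (\<exists>t::real. t < 0 \<and> meets (translate (t *\<^sub>R cross3 (snd l1) (snd l2)) l2) l1)"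

definition constraint :: "oline \<Rightarrow> oline \<Rightarrow> bool" where
  "constraint l0 g \<longleftrightarrow> is_line g \<and> (\<exists>!x. on_line x l0 \<and> on_line x g)"

definition satisfies :: "oline \<Rightarrow> oline \<Rightarrow> bool" where
  "satisfies l g \<longleftrightarrow> meets l g \<or> passes_right l g"

text \<open>F pins l0: there is a neighbourhood of l0 in the space of oriented lines in which
  l0 is the only line satisfying all constraints of F.  The space of oriented lines carries
  the quotient topology of {(p,d). d \<noteq> 0}; since the quotient map is open, neighbourhoods of
  l0 correspond exactly to open sets of representatives containing the representative l0.\<close>
definition pins :: "oline \<Rightarrow> oline set \<Rightarrow> bool" where
  "pins l0 F \<longleftrightarrow> (\<exists>U. open U \<and> l0 \<in> U \<and>
      (\<forall>l\<in>U. is_line l \<and> (\<forall>g\<in>F. satisfies l g) \<longrightarrow> same_oline l0 l))"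

definition minimal_pinning :: "oline \<Rightarrow> oline set \<Rightarrow> bool" where
  "minimal_pinning l0 F \<longleftrightarrow> pins l0 F \<and> (\<forall>F'. F' \<subset> F \<longrightarrow> \<not> pins l0 F')"

definition coplanar3 :: "oline \<Rightarrow> oline \<Rightarrow> oline \<Rightarrow> bool" where
  "coplanar3 a b c \<longleftrightarrow> (\<exists>q n. n \<noteq> 0 \<and>
      (\<forall>y. (on_line y a \<or> on_line y b \<or> on_line y c) \<longrightarrow> (y - q) \<bullet> n = 0))"

definition coplanar_concurrent :: "oline \<Rightarrow> oline \<Rightarrow> oline \<Rightarrow> bool" where
  "coplanar_concurrent l0 g h \<longleftrightarrow>
     (\<exists>x. on_line x l0 \<and> on_line x g \<and> on_line x h) \<and> coplanar3 l0 g h"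

end

theory Submission
  imports Defs
begin

text \<open>
  Identify the lines near \<open>l0\<close> with \<open>x = (u, w)\<close> in \<open>\<real>\<^sup>2 \<times> \<real>\<^sup>2\<close>, where \<open>u\<close> is the position of the line
  at height 0 and \<open>w\<close> its slope.  A constraint becomes an inequality \<open>\<eta> \<bullet> x + \<delta> * Q x \<ge> 0\<close> in which
  \<open>Q x = det (u, w)\<close> is the same quadratic form for all constraints and the covector
  \<open>\<eta> = (n, h n)\<close> is a null vector of \<open>Q\<close>; two covectors are proportional iff the constraints are
  coplanar and concurrent with \<open>l0\<close>.  Let \<open>T\<close> be the cone \<open>{x. \<eta> \<bullet> x \<ge> 0 for all constraints}\<close>.  Then
  \<open>l0\<close> is pinned iff either \<open>T = {0}\<close>, or for some sign \<open>\<sigma>\<close> the linear inequalities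
  \<open>\<eta> \<bullet> x + \<delta> * z \<ge> 0\<close> imply \<open>\<sigma> * z \<ge> 0\<close> and \<open>\<sigma> * Q\<close> is negative on \<open>T - {0}\<close>.

  If \<open>T = {0}\<close>, Steinitz's theorem leaves 8 constraints.  Without proportional covectors
  one starts from a positive circuit of the \<open>\<eta>\<close>s; the delicate case is a circuit of three, whose span
  is a totally isotropic plane, and there the fact that a null vector lies in only two isotropic
  planes excludes minimal configurations with seven elements.

  If \<open>T \<noteq> {0}\<close>, the implication \<open>\<sigma> * z \<ge> 0\<close> is by Farkas and Caratheodory certified by a positive circuit
  of at most five constraints, which alone pins \<open>l0\<close> if it has four or five elements.  A circuit of three
  is impossible since \<open>Q\<close> vanishes on the orthogonal complement of its span.  A circuit of two is a pair
  of opposite covectors; then \<open>Q\<close> factors on the hyperplane orthogonal to them, and six further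
  constraints suffice.
\<close>

section \<open>Duality for finitely generated cones: Farkas, Caratheodory and Steinitz\<close>

section \<open>Finitely generated cones\<close>

text \<open>Families rather than sets of vectors are used because distinct constraints may share a
  covector and the bounds count constraints.\<close>

definition dual_cone :: "('i \<Rightarrow> 'a::real_inner) \<Rightarrow> 'i set \<Rightarrow> 'a set" where
  "dual_cone f I = {x. \<forall>i\<in>I. 0 \<le> f i \<bullet> x}"

text \<open>Independence with multiplicity: a repeated vector counts as a dependence, so
  \<open>card J\<close> itself is bounded by the dimension.\<close>

definition indep_family :: "('i \<Rightarrow> 'a::real_vector) \<Rightarrow> 'i set \<Rightarrow> bool" where
  "indep_family f J \<longleftrightarrow> (\<forall>e. (\<Sum>j\<in>J. e j *\<^sub>R f j) = 0 \<longrightarrow> (\<forall>j\<in>J. e j = 0))"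

lemma dual_coneD: "x \<in> dual_cone f I \<Longrightarrow> i \<in> I \<Longrightarrow> 0 \<le> f i \<bullet> x"
  by (simp add: dual_cone_def)

lemma dual_cone_scale: "x \<in> dual_cone f I \<Longrightarrow> 0 \<le> c \<Longrightarrow> c *\<^sub>R x \<in> dual_cone f I"
  by (simp add: dual_cone_def)

lemma dual_cone_add: "x \<in> dual_cone f I \<Longrightarrow> y \<in> dual_cone f I \<Longrightarrow> x + y \<in> dual_cone f I"
  by (simp add: dual_cone_def inner_add_right)

lemma dual_cone_antimono: "J \<subseteq> I \<Longrightarrow> dual_cone f I \<subseteq> dual_cone f J"
  by (auto simp: dual_cone_def)

lemma zero_in_dual_cone [simp]: "0 \<in> dual_cone f I"
  by (simp add: dual_cone_def)

lemma scaleR_if: "(if P then c else 0) *\<^sub>R x = (if P then c *\<^sub>R x else (0::'a::real_vector))"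
  by simp

lemma indep_family_inj_on:
  assumes "finite J" "indep_family f J"
  shows "inj_on f J"
proof (rule inj_onI, rule ccontr)
  fix a b assume ab: "a \<in> J" "b \<in> J" "f a = f b" "a \<noteq> b"
  define e where "e = (\<lambda>j. if j = a then 1 else if j = b then -1 else (0::real))"
  have "(\<Sum>j\<in>J. e j *\<^sub>R f j) = (\<Sum>j\<in>{a,b}. e j *\<^sub>R f j)"
    using assms ab by (intro sum.mono_neutral_right) (auto simp: e_def)
  also have "\<dots> = 0" using ab by (simp add: e_def)
  finally show False using assms(2) ab(1) by (auto simp: indep_family_def e_def dest!: spec[of _ e])
qed

lemma indep_family_independent:
  assumes "finite J" "indep_family f J"
  shows "independent (f ` J)"
proof
  assume "dependent (f ` J)"
  then obtain u v where u: "v \<in> f ` J" "u v \<noteq> 0" "(\<Sum>v\<in>f ` J. u v *\<^sub>R v) = 0"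
    using assms by (auto simp: dependent_finite)
  have "(\<Sum>j\<in>J. u (f j) *\<^sub>R f j) = 0"
    using u(3) by (simp add: sum.reindex indep_family_inj_on[OF assms] o_def)
  then have "\<forall>j\<in>J. u (f j) = 0" using assms(2) by (auto simp: indep_family_def dest!: spec[of _ "\<lambda>j. u (f j)"])
  then show False using u by auto
qed

lemma card_indep_family_le_dim:
  fixes f :: "'i \<Rightarrow> 'a::euclidean_space"
  assumes "finite J" "indep_family f J" "f ` J \<subseteq> V"
  shows "card J \<le> dim V"
  using independent_card_le_dim[OF assms(3) indep_family_independent[OF assms(1,2)]]
    card_image[OF indep_family_inj_on[OF assms(1,2)]] by simp

lemma card_indep_family_le_DIM:
  fixes f :: "'i \<Rightarrow> 'a::euclidean_space"
  assumes "finite J" "indep_family f J"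
  shows "card J \<le> DIM('a)"
  using card_indep_family_le_dim[OF assms subset_UNIV] by simp

lemma indep_family_span:
  fixes f :: "'i \<Rightarrow> 'a::euclidean_space"
  assumes "finite J" "indep_family f J" "f ` J \<subseteq> V" "dim V \<le> card J"
  shows "V \<subseteq> span (f ` J)"
  using assms by (metis card_ge_dim_independent card_image indep_family_independent indep_family_inj_on)

lemma in_span_family:
  assumes "finite J" "x \<in> span (f ` J)"
  shows "\<exists>e. x = (\<Sum>j\<in>J. e j *\<^sub>R f j)"
  using assms(2)
proof (induction rule: span_induct_alt)
  case base
  show ?case by (intro exI[of _ "\<lambda>_. 0"]) simp
next
  case (step c x y)
  then obtain i e where i: "i \<in> J" "x = f i" "y = (\<Sum>j\<in>J. e j *\<^sub>R f j)" by auto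
  have "(\<Sum>j\<in>J. (if j = i then c else 0) *\<^sub>R f j) = c *\<^sub>R f i"
    using assms(1) i by (simp add: scaleR_if)
  then show ?case
    by (intro exI[of _ "\<lambda>j. (if j = i then c else 0) + e j"])
       (simp add: i scaleR_left_distrib sum.distrib)
qed

text \<open>Dimension count: the orthogonal complement of the \<open>f j\<close> has dimension
  \<open>card K\<close> and contains the independent vectors \<open>g k\<close>, so they span
  it.\<close>

lemma orthogonal_indep_families_span:
  fixes f :: "'i \<Rightarrow> 'a::euclidean_space" and g :: "'k \<Rightarrow> 'a"
  assumes "finite J" "indep_family f J" "finite K" "indep_family g K"
    and "card J + card K = DIM('a)"
    and "\<And>j k. j \<in> J \<Longrightarrow> k \<in> K \<Longrightarrow> f j \<bullet> g k = 0"
    and "\<And>j. j \<in> J \<Longrightarrow> f j \<bullet> x = 0"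
  shows "x \<in> span (g ` K)"
proof -
  let ?P = "{y::'a. \<forall>v\<in>span (f ` J). orthogonal v y}"
  have P: "y \<in> ?P" if "\<And>j. j \<in> J \<Longrightarrow> f j \<bullet> y = 0" for y
  proof (intro CollectI ballI)
    fix v assume "v \<in> span (f ` J)"
    then have "orthogonal y v"
      by (rule orthogonal_to_span) (use that in \<open>auto simp: orthogonal_def inner_commute\<close>)
    then show "orthogonal v y" by (simp add: orthogonal_commute)
  qed
  have "dim ?P + dim (span (f ` J)) = dim (UNIV :: 'a set)"
    using dim_subspace_orthogonal_to_vectors[of "span (f ` J)" UNIV] by simp
  moreover have "dim (span (f ` J)) = card J"
    using assms(1,2) by (simp add: dim_eq_card_independent indep_family_independent card_image indep_family_inj_on)
  ultimately have "dim ?P = card K" using assms(5) by simp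
  moreover have "g ` K \<subseteq> ?P" using P assms(6) by blast
  ultimately have "?P \<subseteq> span (g ` K)" using indep_family_span[OF assms(3,4)] by simp
  then show ?thesis using P assms(7) by blast
qed

lemma indep_family_orthogonal_imp_zero:
  fixes f :: "'i \<Rightarrow> 'a::euclidean_space"
  assumes "finite J" "indep_family f J" "card J = DIM('a)" "\<And>j. j \<in> J \<Longrightarrow> f j \<bullet> x = 0"
  shows "x = 0"
  using orthogonal_indep_families_span[OF assms(1,2), of "{}" id x] assms(3,4)
  by (simp add: indep_family_def)

text \<open>A finitely generated cone is closed, so a \<open>v\<close> outside it could be strictly
  separated from it; the normal of the separating hyperplane would lie in the dual cone and be
  negative on \<open>v\<close>.\<close>

lemma farkas_finite:
  fixes f :: "'i \<Rightarrow> 'a::euclidean_space"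
  assumes fin: "finite I" and v: "\<And>x. x \<in> dual_cone f I \<Longrightarrow> 0 \<le> v \<bullet> x"
  shows "\<exists>c. (\<forall>i\<in>I. 0 \<le> c i) \<and> v = (\<Sum>i\<in>I. c i *\<^sub>R f i)"
proof -
  let ?K = "convex_cone hull (f ` I)"
  let ?R = "{w. \<exists>c. (\<forall>i\<in>I. 0 \<le> c i) \<and> w = (\<Sum>i\<in>I. c i *\<^sub>R f i)}"
  have "v \<in> ?K"
  proof (rule ccontr)
    assume "v \<notin> ?K"
    then obtain a b where ab: "a \<bullet> v < b" "\<And>x. x \<in> ?K \<Longrightarrow> b < a \<bullet> x"
      using separating_hyperplane_closed_point[of ?K v] closed_convex_cone_hull[of "f ` I"] fin
        convex_convex_cone_hull[of "f ` I"] by auto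
    have b0: "b < 0" using ab(2)[OF convex_cone_hull_contains_0] by simp
    have "0 \<le> a \<bullet> f i" if i: "i \<in> I" for i
    proof (rule ccontr)
      assume n: "\<not> 0 \<le> a \<bullet> f i"
      \<comment> \<open>The multiple of \<open>f i\<close> at which the functional takes exactly the
        value \<open>b\<close>, contradicting strict separation.\<close>
      define c where "c = b / (a \<bullet> f i)"
      have "c *\<^sub>R f i \<in> ?K"
        using n b0 i by (intro convex_cone_hull_mul hull_inc) (auto simp: c_def divide_nonpos_neg)
      from ab(2)[OF this] n show False by (simp add: c_def)
    qed
    then have "a \<in> dual_cone f I" by (simp add: dual_cone_def inner_commute)
    with v[of a] ab(1) b0 show False by (simp add: inner_commute)
  qed
  moreover have "?K \<subseteq> ?R"
  proof (rule hull_minimal)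
    show "f ` I \<subseteq> ?R"
    proof clarify
      fix i assume i: "i \<in> I"
      have "f i = (\<Sum>j\<in>I. (if j = i then 1 else 0) *\<^sub>R f j)"
        using fin i by (simp add: scaleR_if)
      then show "\<exists>c. (\<forall>i\<in>I. 0 \<le> c i) \<and> f i = (\<Sum>i\<in>I. c i *\<^sub>R f i)"
        by (intro exI[of _ "\<lambda>j. if j = i then 1 else 0"]) auto
    qed
    have add: "x + y \<in> ?R" if "x \<in> ?R" "y \<in> ?R" for x y
    proof -
      from that obtain c d where "\<forall>i\<in>I. 0 \<le> c i" "x = (\<Sum>i\<in>I. c i *\<^sub>R f i)"
        "\<forall>i\<in>I. 0 \<le> d i" "y = (\<Sum>i\<in>I. d i *\<^sub>R f i)" by blast
      then show ?thesis
        by (intro CollectI exI[of _ "\<lambda>i. c i + d i"]) (simp add: scaleR_left_distrib sum.distrib)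
    qed
    have scale: "t *\<^sub>R x \<in> ?R" if "x \<in> ?R" "0 \<le> t" for x t
    proof -
      from that obtain c where "\<forall>i\<in>I. 0 \<le> c i" "x = (\<Sum>i\<in>I. c i *\<^sub>R f i)" by blast
      then show ?thesis using that(2)
        by (intro CollectI exI[of _ "\<lambda>i. t * c i"]) (simp add: scaleR_sum_right)
    qed
    have "0 \<in> ?R" by (intro CollectI exI[of _ "\<lambda>_. 0"]) simp
    then show "convex_cone ?R" unfolding convex_cone_iff using add scale by blast
  qed
  ultimately show ?thesis by blast
qed

text \<open>While the family is dependent, moving the coefficients along a linear relation makes one
  of them vanish and keeps the rest nonnegative; induction on the size of the family.\<close>

lemma conic_caratheodory:
  fixes f :: "'i \<Rightarrow> 'a::real_vector"
  assumes fin: "finite I" and c: "\<And>i. i \<in> I \<Longrightarrow> 0 \<le> c i" and v: "v = (\<Sum>i\<in>I. c i *\<^sub>R f i)"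
  obtains J d where "J \<subseteq> I" "indep_family f J" "\<And>j. j \<in> J \<Longrightarrow> 0 < d j"
    "v = (\<Sum>j\<in>J. d j *\<^sub>R f j)"
proof -
  have "\<exists>J d. J \<subseteq> I \<and> indep_family f J \<and> (\<forall>j\<in>J. 0 < d j) \<and> v = (\<Sum>j\<in>J. d j *\<^sub>R f j)"
    using fin c v
  proof (induction "card I" arbitrary: I c rule: less_induct)
    case less
    have smaller: ?case if i: "i \<in> I" and ci: "c' i = 0" and c': "\<And>i. i \<in> I \<Longrightarrow> 0 \<le> c' i"
      and v': "v = (\<Sum>i\<in>I. c' i *\<^sub>R f i)" for i c'
    proof -
      have "v = (\<Sum>j\<in>I - {i}. c' j *\<^sub>R f j)"
        using less.prems(1) i ci v' by (simp add: sum.remove)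
      then obtain J d where "J \<subseteq> I - {i}" "indep_family f J" "\<forall>j\<in>J. 0 < d j" "v = (\<Sum>j\<in>J. d j *\<^sub>R f j)"
        using less.hyps[of "I - {i}" c'] card_Diff1_less[OF less.prems(1) i] less.prems(1) c' by auto
      then show ?thesis by blast
    qed
    show ?case
    proof (cases "\<exists>i\<in>I. c i = 0")
      case True
      then show ?thesis using smaller less.prems by blast
    next
      case False
      then have pos: "\<And>i. i \<in> I \<Longrightarrow> 0 < c i" using less.prems(2) by fastforce
      show ?thesis
      proof (cases "indep_family f I")
        case True
        then show ?thesis using pos less.prems(3) by blast
      next
        case False
        then obtain e0 k where e0: "(\<Sum>i\<in>I. e0 i *\<^sub>R f i) = 0" "k \<in> I" "e0 k \<noteq> 0"
          by (auto simp: indep_family_def)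
        \<comment> \<open>The sign is chosen so that some coefficient decreases along the
          relation.\<close>
        define e where "e = (\<lambda>i. if e0 k < 0 then e0 i else - e0 i)"
        have e: "(\<Sum>i\<in>I. e i *\<^sub>R f i) = 0" "k \<in> I" "e k < 0"
          using e0 by (cases "e0 k < 0"; simp add: e_def sum_negf)+
        define N where "N = {i\<in>I. e i < 0}"
        have N: "finite N" "N \<noteq> {}" using less.prems(1) e by (auto simp: N_def)
        obtain m where m: "m \<in> N" "\<And>i. i \<in> N \<Longrightarrow> c m / - e m \<le> c i / - e i"
        proof -
          have "Min ((\<lambda>i. c i / - e i) ` N) \<in> (\<lambda>i. c i / - e i) ` N" using N by (intro Min_in) auto
          then obtain m where "m \<in> N" "Min ((\<lambda>i. c i / - e i) ` N) = c m / - e m" by blast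
          moreover have "Min ((\<lambda>i. c i / - e i) ` N) \<le> c i / - e i" if "i \<in> N" for i
            using N that by (intro Min_le) auto
          ultimately show thesis using that[of m] by simp
        qed
        \<comment> \<open>The largest step that keeps all coefficients nonnegative; the one at
          \<open>m\<close> becomes zero.\<close>
        define t where "t = c m / - e m"
        have t0: "0 \<le> t" using m pos by (auto simp: t_def N_def divide_nonneg_neg less_imp_le)
        define c' where "c' = (\<lambda>i. c i + t * e i)"
        have "c' m = 0" using m(1) by (simp add: c'_def t_def N_def)
        moreover have "0 \<le> c' i" if "i \<in> I" for i
        proof (cases "e i < 0")
          case True
          then have "t \<le> c i / - e i" using that m(2) by (simp add: t_def N_def)
          then have "t * - e i \<le> c i" using True pos_le_divide_eq[of "- e i" t "c i"] by simp
          then show ?thesis by (simp add: c'_def)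
        next
          case False
          then show ?thesis using t0 pos[OF that] by (simp add: c'_def)
        qed
        moreover have "v = (\<Sum>i\<in>I. c' i *\<^sub>R f i)"
          using e(1) less.prems(3)
          by (simp add: c'_def scaleR_left_distrib sum.distrib flip: scaleR_scaleR scaleR_sum_right)
        moreover have "m \<in> I" using m by (simp add: N_def)
        ultimately show ?thesis using smaller by blast
      qed
    qed
  qed
  then show ?thesis using that by blast
qed

text \<open>A symmetric dual cone is the orthogonal complement of all \<open>f i\<close>. A basis
  among them, together with a conic representation of minus its sum, cuts out the same space: both
  groups pair nonnegatively with \<open>x\<close> and their weighted total is zero, so every basis
  vector is orthogonal to \<open>x\<close>.\<close>

lemma steinitz_symmetric:
  fixes f :: "'i \<Rightarrow> 'a::euclidean_space"
  assumes fin: "finite I" and sym: "\<And>x. x \<in> dual_cone f I \<Longrightarrow> - x \<in> dual_cone f I"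
  obtains J where "J \<subseteq> I" "dual_cone f J = dual_cone f I" "card J \<le> 2 * dim (f ` I)"
proof -
  obtain B where B: "B \<subseteq> f ` I" "independent B" "f ` I \<subseteq> span B" "card B = dim (f ` I)"
    using basis_exists by blast
  obtain J0 where J0: "J0 \<subseteq> I" "inj_on f J0" "B = f ` J0"
    using B(1) by (auto simp: subset_image_inj)
  have finJ0: "finite J0" using fin J0 finite_subset by blast
  define v where "v = - (\<Sum>j\<in>J0. f j)"
  have "0 \<le> v \<bullet> x" if "x \<in> dual_cone f I" for x
  proof -
    have "0 \<le> (\<Sum>j\<in>J0. f j \<bullet> - x)"
      using sym[OF that] J0(1) by (intro sum_nonneg) (auto dest!: dual_coneD)
    then show ?thesis by (simp add: v_def inner_sum_left sum_negf)
  qed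
  from farkas_finite[OF fin this] obtain c where "\<forall>i\<in>I. 0 \<le> c i" "v = (\<Sum>i\<in>I. c i *\<^sub>R f i)" by blast
  then obtain J1 d where J1: "J1 \<subseteq> I" "indep_family f J1" "\<And>j. j \<in> J1 \<Longrightarrow> 0 < d j"
    "v = (\<Sum>j\<in>J1. d j *\<^sub>R f j)" using conic_caratheodory[OF fin, of c v f] by blast
  have finJ1: "finite J1" using fin J1 finite_subset by blast
  have "card J1 \<le> dim (f ` I)" by (rule card_indep_family_le_dim) (use finJ1 J1 in auto)
  moreover have "card J0 = dim (f ` I)" using B(4) J0 by (simp add: card_image)
  ultimately have "card (J0 \<union> J1) \<le> 2 * dim (f ` I)" using card_Un_le[of J0 J1] by linarith
  moreover have "dual_cone f (J0 \<union> J1) \<subseteq> dual_cone f I"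
  proof
    fix x assume x: "x \<in> dual_cone f (J0 \<union> J1)"
    have "0 = (\<Sum>j\<in>J0. f j \<bullet> x) + (\<Sum>j\<in>J1. d j * (f j \<bullet> x))"
      using arg_cong[OF J1(4), of "\<lambda>v. v \<bullet> x"] by (simp add: v_def inner_sum_left)
    moreover have "0 \<le> (\<Sum>j\<in>J1. d j * (f j \<bullet> x))"
      using x J1(3) by (intro sum_nonneg) (auto simp: dual_cone_def less_imp_le)
    moreover have nn: "\<And>j. j \<in> J0 \<Longrightarrow> 0 \<le> f j \<bullet> x" using x by (auto simp: dual_cone_def)
    moreover have "0 \<le> (\<Sum>j\<in>J0. f j \<bullet> x)" using nn by (rule sum_nonneg)
    ultimately have "(\<Sum>j\<in>J0. f j \<bullet> x) = 0" by linarith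
    then have "\<And>j. j \<in> J0 \<Longrightarrow> f j \<bullet> x = 0" using nn finJ0 sum_nonneg_eq_0_iff[of J0 "\<lambda>j. f j \<bullet> x"] by simp
    then have "\<And>b. b \<in> B \<Longrightarrow> orthogonal x b" using J0(3) by (auto simp: orthogonal_def inner_commute)
    then have "f i \<bullet> x = 0" if "i \<in> I" for i
      using B(3) that orthogonal_to_span[of "f i" B x] by (auto simp: orthogonal_def inner_commute)
    then show "x \<in> dual_cone f I" by (simp add: dual_cone_def)
  qed
  then have "dual_cone f (J0 \<union> J1) = dual_cone f I"
    using dual_cone_antimono[of "J0 \<union> J1" I f] J0(1) J1(1) by auto
  ultimately show ?thesis using that[of "J0 \<union> J1"] J0(1) J1(1) by blast
qed

section \<open>A local criterion for linear inequalities perturbed by a common quadratic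
  form\<close>

section \<open>Isolated points of a linear-quadratic system\<close>

definition isolated_origin :: "('i \<Rightarrow> 'a::euclidean_space) \<Rightarrow> ('i \<Rightarrow> real) \<Rightarrow> ('a \<Rightarrow> real) \<Rightarrow> 'i set \<Rightarrow> bool" where
  "isolated_origin n \<delta> q I \<longleftrightarrow>
     (\<exists>r>0. \<forall>x. norm x < r \<and> (\<forall>i\<in>I. 0 \<le> n i \<bullet> x + \<delta> i * q x) \<longrightarrow> x = 0)"

text \<open>The first conjunct replaces \<open>q x\<close> by an independent variable
  \<open>z\<close>, which makes it a linear implication accessible to Farkas; the second gives
  \<open>q\<close> the opposite sign on the nonzero elements of the cone.\<close>

definition one_sided :: "('i \<Rightarrow> 'a::euclidean_space) \<Rightarrow> ('i \<Rightarrow> real) \<Rightarrow> ('a \<Rightarrow> real) \<Rightarrow> real \<Rightarrow> 'i set \<Rightarrow> bool" where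
  "one_sided n \<delta> q \<sigma> I \<longleftrightarrow>
     (\<forall>x z. (\<forall>i\<in>I. 0 \<le> n i \<bullet> x + \<delta> i * z) \<longrightarrow> 0 \<le> \<sigma> * z) \<and>
     (\<forall>x\<in>dual_cone n I. x \<noteq> 0 \<longrightarrow> \<sigma> * q x < 0)"

text \<open>Otherwise nonzero solutions converge to the origin, and a limit \<open>l\<close> of
  their normalizations lies in the dual cone because the quadratic term is of second order. Since
  \<open>l\<close> is nonzero, the cone is not trivial; one-sidedness then makes
  \<open>\<sigma> * q\<close> nonnegative along the sequence, hence at \<open>l\<close>, where it
  should be negative.\<close>

lemma isolated_originI:
  fixes n :: "'i \<Rightarrow> 'a::euclidean_space"
  assumes cont: "continuous_on UNIV q" and hom: "\<And>c x. q (c *\<^sub>R x) = c\<^sup>2 * q x"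
    and alt: "dual_cone n I = {0} \<or> one_sided n \<delta> q \<sigma> I"
  shows "isolated_origin n \<delta> q I"
proof (rule ccontr)
  assume "\<not> isolated_origin n \<delta> q I"
  then have "\<exists>x. norm x < 1 / Suc k \<and> (\<forall>i\<in>I. 0 \<le> n i \<bullet> x + \<delta> i * q x) \<and> x \<noteq> 0" for k
    unfolding isolated_origin_def by (metis of_nat_0_less_iff zero_less_Suc zero_less_divide_1_iff)
  then obtain x where x: "\<And>k. norm (x k) < 1 / Suc k" "\<And>k. x k \<noteq> 0"
    "\<And>k i. i \<in> I \<Longrightarrow> 0 \<le> n i \<bullet> x k + \<delta> i * q (x k)" by metis
  define y where "y = (\<lambda>k. x k /\<^sub>R norm (x k))"
  have "\<And>k. y k \<in> sphere 0 1" using x(2) by (simp add: y_def)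
  then obtain l s where l: "l \<in> sphere 0 1" "strict_mono s" "(y \<circ> s) \<longlonglongrightarrow> l"
    using compact_sphere[of 0 "1::real"] unfolding compact_def by metis
  have xy: "x k = norm (x k) *\<^sub>R y k" for k using x(2) by (simp add: y_def)
  have inv: "(\<lambda>k. 1 / Suc k) \<longlonglongrightarrow> (0::real)" using LIMSEQ_inverse_real_of_nat by (simp add: inverse_eq_divide)
  have "(\<lambda>k. norm (x k)) \<longlonglongrightarrow> 0"
    by (rule tendsto_sandwich[OF _ _ tendsto_const inv]) (auto simp del: of_nat_Suc intro!: always_eventually less_imp_le[OF x(1)])
  then have nx: "(\<lambda>k. norm (x (s k))) \<longlonglongrightarrow> 0" using LIMSEQ_subseq_LIMSEQ[OF _ l(2)] by (auto simp: o_def)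
  have yl: "(\<lambda>k. y (s k)) \<longlonglongrightarrow> l" using l(3) by (simp add: o_def)
  have qy: "(\<lambda>k. q (y (s k))) \<longlonglongrightarrow> q l"
    using cont yl by (intro continuous_on_tendsto_compose[OF cont]) auto
  have "0 \<le> n i \<bullet> l" if i: "i \<in> I" for i
  proof -
    have "(\<lambda>k. n i \<bullet> y (s k) + \<delta> i * (norm (x (s k)) * q (y (s k)))) \<longlonglongrightarrow> n i \<bullet> l + \<delta> i * (0 * q l)"
      by (intro tendsto_intros nx yl qy)
    moreover have "0 \<le> n i \<bullet> y (s k) + \<delta> i * (norm (x (s k)) * q (y (s k)))" for k
    proof -
      have "0 \<le> norm (x (s k)) * (n i \<bullet> y (s k) + \<delta> i * (norm (x (s k)) * q (y (s k))))"
      proof -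
        have "n i \<bullet> x (s k) = norm (x (s k)) * (n i \<bullet> y (s k))"
          by (subst xy) simp
        moreover have "q (x (s k)) = (norm (x (s k)))\<^sup>2 * q (y (s k))"
          by (subst xy) (simp only: hom)
        ultimately show ?thesis using x(3)[OF i, of "s k"] by (simp add: algebra_simps power2_eq_square)
      qed
      then show ?thesis using x(2)[of "s k"] by (simp add: zero_le_mult_iff)
    qed
    ultimately show ?thesis using LIMSEQ_le_const[of _ _ 0] by fastforce
  qed
  then have ld: "l \<in> dual_cone n I" by (simp add: dual_cone_def)
  moreover have l0: "l \<noteq> 0" using l(1) by auto
  ultimately have os: "one_sided n \<delta> q \<sigma> I" using alt by auto
  then have neg: "\<sigma> * q l < 0" using ld l0 by (simp add: one_sided_def)
  have "0 \<le> \<sigma> * q (y (s k))" for k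
  proof -
    have "0 \<le> \<sigma> * q (x (s k))" using os x(3) unfolding one_sided_def by blast
    then have "0 \<le> (norm (x (s k)))\<^sup>2 * (\<sigma> * q (y (s k)))"
      using hom[of "norm (x (s k))" "y (s k)"] by (simp add: mult.left_commute flip: xy)
    then show ?thesis using x(2)[of "s k"] by (simp add: zero_le_mult_iff)
  qed
  moreover have "(\<lambda>k. \<sigma> * q (y (s k))) \<longlonglongrightarrow> \<sigma> * q l" by (intro tendsto_intros qy)
  ultimately have "0 \<le> \<sigma> * q l" using LIMSEQ_le_const[of _ _ 0] by blast
  with neg show False by simp
qed

text \<open>If \<open>q t\<close> vanished, all positive multiples of \<open>t\<close> would satisfy
  the inequalities.\<close>

lemma isolated_origin_quadratic_nonzero:
  fixes n :: "'i \<Rightarrow> 'a::euclidean_space"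
  assumes "isolated_origin n \<delta> q I" and hom: "\<And>c x. q (c *\<^sub>R x) = c\<^sup>2 * q x"
    and "t \<in> dual_cone n I" "t \<noteq> 0"
  shows "q t \<noteq> 0"
proof
  assume qt: "q t = 0"
  obtain r where r: "r > 0" "\<And>x. norm x < r \<Longrightarrow> (\<forall>i\<in>I. 0 \<le> n i \<bullet> x + \<delta> i * q x) \<Longrightarrow> x = 0"
    using assms(1) by (auto simp: isolated_origin_def)
  have "(r / (2 * norm t)) *\<^sub>R t = 0"
    using r(1) assms(3,4) qt by (intro r(2)) (auto simp: hom dual_cone_def)
  then show False using r(1) assms(4) by simp
qed

text \<open>Converse of the criterion for a nontrivial cone. The sign comes from one nonzero
  \<open>t\<close> in the cone; a violation of either half is connected to \<open>t\<close> by a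
  path on which the intermediate value theorem finds a point contradicting isolation.\<close>

lemma isolated_origin_one_sided:
  fixes n :: "'i \<Rightarrow> 'a::euclidean_space"
  assumes iso: "isolated_origin n \<delta> q I" and cont: "continuous_on UNIV q"
    and hom: "\<And>c x. q (c *\<^sub>R x) = c\<^sup>2 * q x" and nt: "dual_cone n I \<noteq> {0}"
  obtains \<sigma> where "\<bar>\<sigma>\<bar> = 1" "one_sided n \<delta> q \<sigma> I"
proof -
  obtain r where r: "r > 0" "\<And>x. norm x < r \<Longrightarrow> (\<forall>i\<in>I. 0 \<le> n i \<bullet> x + \<delta> i * q x) \<Longrightarrow> x = 0"
    using iso by (auto simp: isolated_origin_def)
  obtain t where t: "t \<in> dual_cone n I" "t \<noteq> 0" using nt zero_in_dual_cone[of n I] by blast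
  have qnz: "q x \<noteq> 0" if "x \<in> dual_cone n I" "x \<noteq> 0" for x
    using isolated_origin_quadratic_nonzero[OF iso hom that] .
  define \<sigma> where "\<sigma> = - sgn (q t)"
  have \<sigma>: "\<bar>\<sigma>\<bar> = 1" "\<sigma> * q t < 0" "\<sigma> * \<sigma> = 1" using qnz[OF t] by (auto simp: \<sigma>_def sgn_if)
  have "0 \<le> \<sigma> * z" if xz: "\<forall>i\<in>I. 0 \<le> n i \<bullet> x + \<delta> i * z" for x z
  proof (rule ccontr)
    assume neg: "\<not> 0 \<le> \<sigma> * z"
    define w where "w = - (\<sigma> * z)"
    have w: "w > 0" "z = - (\<sigma> * w)" using neg \<sigma>(3) by (auto simp: w_def mult.assoc[symmetric])
    define A where "A = - (\<sigma> * q t)"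
    define B where "B = - (\<sigma> * q (t + x))"
    have A: "A > 0" using \<sigma>(2) by (simp add: A_def)
    \<comment> \<open>The first bound keeps the solution constructed below within radius
      \<open>r\<close>, the second makes \<open>g 1\<close> nonnegative.\<close>
    define e where "e = min (r / (2 * (norm t + norm x))) (w / (\<bar>B\<bar> + 1))"
    have nt: "norm t > 0" using t by simp
    have e0: "e > 0" unfolding e_def using r(1) w nt by (auto intro!: divide_pos_pos add_pos_nonneg)
    have e1: "e * (norm t + norm x) < r"
    proof -
      have "e \<le> r / (2 * (norm t + norm x))" by (simp add: e_def)
      moreover have "0 < 2 * (norm t + norm x)" using nt by (simp add: add_pos_nonneg)
      ultimately have "e * (2 * (norm t + norm x)) \<le> r" by (metis pos_le_divide_eq)
      moreover have "e * (norm t + norm x) > 0" using e0 nt by (simp add: add_pos_nonneg)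
      ultimately show ?thesis by linarith
    qed
    have e2: "e * B < w"
    proof -
      have "e \<le> w / (\<bar>B\<bar> + 1)" by (simp add: e_def)
      moreover have "0 < \<bar>B\<bar> + 1" by linarith
      ultimately have "e * (\<bar>B\<bar> + 1) \<le> w" by (metis pos_le_divide_eq)
      moreover have "e * B < e * (\<bar>B\<bar> + 1)" using e0 by simp
      ultimately show ?thesis by linarith
    qed
    \<comment> \<open>At a zero \<open>s\<close> of \<open>g\<close> the form takes the value
      \<open>e * (s * z)\<close> at the point \<open>?y\<close> below, so its inequalities are
      nonnegative combinations of those of \<open>t\<close> and of the pair \<open>x\<close>,
      \<open>z\<close>.\<close>
    define g where "g = (\<lambda>s. s * w + e * (\<sigma> * q (t + s *\<^sub>R x)))"
    have "continuous_on {0..1} g" unfolding g_def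
      by (intro continuous_intros continuous_on_compose2[OF cont]) auto
    moreover have "g 0 \<le> 0" using e0 \<sigma>(2) by (simp add: g_def mult_nonneg_nonpos less_imp_le)
    moreover have "0 \<le> g 1" using e2 by (simp add: g_def B_def)
    ultimately obtain s where s: "0 \<le> s" "s \<le> 1" "g s = 0"
      using IVT'[of g 0 0 1] by auto
    let ?y = "e *\<^sub>R (t + s *\<^sub>R x)"
    have "norm ?y \<le> e * (norm t + norm x)"
      using e0 s norm_triangle_ineq[of t "s *\<^sub>R x"] mult_right_mono[OF s(2) norm_ge_zero[of x]] by auto
    then have "norm ?y < r" using e1 by simp
    moreover have "0 \<le> n i \<bullet> ?y + \<delta> i * q ?y" if i: "i \<in> I" for i
    proof -
      have "e * (\<sigma> * q (t + s *\<^sub>R x)) = - (s * w)" using s(3) by (simp add: g_def)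
      then have "\<sigma> * (\<sigma> * (e * q (t + s *\<^sub>R x))) = \<sigma> * - (s * w)" by (simp add: algebra_simps)
      then have "e * q (t + s *\<^sub>R x) = s * z" using \<sigma>(3) w(2) by (simp add: mult.assoc[symmetric]) 
      then have "q ?y = e * (s * z)" by (simp add: hom power2_eq_square)
      then have "n i \<bullet> ?y + \<delta> i * q ?y = e * (n i \<bullet> t) + e * s * (n i \<bullet> x + \<delta> i * z)"
        by (simp add: inner_add_right algebra_simps)
      then show ?thesis using e0 s xz i t(1) by (simp add: dual_cone_def)
    qed
    ultimately have "?y = 0" using r(2) by blast
    then have ts: "t + s *\<^sub>R x = 0" using e0 by simp
    have "q 0 = 0" using hom[of 0 0] by simp
    then have "s = 0" using s(3) w(1) ts by (simp add: g_def)
    then show False using ts t by simp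
  qed
  moreover have "\<sigma> * q x < 0" if x: "x \<in> dual_cone n I" "x \<noteq> 0" for x
  proof (rule ccontr)
    assume "\<not> \<sigma> * q x < 0"
    define g where "g = (\<lambda>s. \<sigma> * q ((1 - s) *\<^sub>R t + s *\<^sub>R x))"
    have "continuous_on {0..1} g" unfolding g_def
      by (intro continuous_intros continuous_on_compose2[OF cont]) auto
    then obtain s where s: "0 \<le> s" "s \<le> 1" "g s = 0"
      using IVT'[of g 0 0 1] \<sigma>(2) \<open>\<not> \<sigma> * q x < 0\<close> by (auto simp: g_def)
    have "(1 - s) *\<^sub>R t + s *\<^sub>R x \<in> dual_cone n I"
      using s t(1) x(1) by (intro dual_cone_add dual_cone_scale) auto
    then have z: "(1 - s) *\<^sub>R t + s *\<^sub>R x = 0" using qnz s(3) \<sigma>(1) by (auto simp: g_def)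
    \<comment> \<open>The only zero of \<open>q\<close> in the cone is the origin, so the segment
      passes through it: \<open>x\<close> is a multiple of \<open>t\<close>, and by homogeneity
      \<open>q\<close> cannot have the opposite sign at \<open>x\<close>.\<close>
    then have s0: "s \<noteq> 0" using t by auto
    have "s *\<^sub>R x = (- (1 - s)) *\<^sub>R t"
      using z by (simp only: scaleR_minus_left eq_neg_iff_add_eq_0 add.commute)
    then have "(1 / s) *\<^sub>R (s *\<^sub>R x) = (1 / s) *\<^sub>R ((- (1 - s)) *\<^sub>R t)" by (rule arg_cong)
    then have "x = (- ((1 - s) / s)) *\<^sub>R t" using s0 by (simp add: diff_divide_distrib)
    then have "q x = (- ((1 - s) / s))\<^sup>2 * q t" by (simp only: hom)
    then have "\<sigma> * q x = ((1 - s) / s)\<^sup>2 * (\<sigma> * q t)" by simp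
    moreover have "\<dots> \<le> 0"
      using mult_nonneg_nonpos[OF zero_le_power2 less_imp_le[OF \<sigma>(2)]] .
    moreover have "\<sigma> * q x \<noteq> 0" using qnz[OF x] \<sigma>(1) by auto
    ultimately show False using \<open>\<not> \<sigma> * q x < 0\<close> by linarith
  qed
  ultimately have "one_sided n \<delta> q \<sigma> I" by (simp add: one_sided_def)
  then show ?thesis using that \<sigma>(1) by blast
qed

section \<open>Null vectors of a form of signature (2,2), and the case of a trivial cone\<close>

section \<open>Null vectors of the Klein quadric\<close>

type_synonym quad = "(real \<times> real) \<times> (real \<times> real)"

definition klein_form :: "quad \<Rightarrow> real" where
  "klein_form x = fst (fst x) * snd (snd x) - snd (fst x) * fst (snd x)"

text \<open>The symmetric matrix of the polar form: \<open>x \<bullet> klein_polar y\<close> is the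
  bilinear form associated with \<open>klein_form\<close>. It is an involution preserving the form
  and identifies vectors with covectors.\<close>

definition klein_polar :: "quad \<Rightarrow> quad" where
  "klein_polar x = ((snd (snd x), - fst (snd x)), (- snd (fst x), fst (fst x)))"

lemma klein_polar_polar [simp]: "klein_polar (klein_polar x) = x"
  by (simp add: klein_polar_def)

lemma klein_polar_0 [simp]: "klein_polar 0 = 0"
  by (simp add: klein_polar_def zero_prod_def)

lemma klein_polar_add: "klein_polar (x + y) = klein_polar x + klein_polar y"
  by (simp add: klein_polar_def)

lemma klein_polar_scaleR: "klein_polar (c *\<^sub>R x) = c *\<^sub>R klein_polar x"
  by (simp add: klein_polar_def)

lemma inner_klein_polar_commute: "x \<bullet> klein_polar y = y \<bullet> klein_polar x"
  by (simp add: klein_polar_def inner_prod_def)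

lemma inner_klein_polar_self: "x \<bullet> klein_polar x = 2 * klein_form x"
  by (simp add: klein_polar_def klein_form_def inner_prod_def)

lemma klein_form_add: "klein_form (x + y) = klein_form x + klein_form y + x \<bullet> klein_polar y"
  by (simp add: klein_form_def klein_polar_def inner_prod_def algebra_simps)

lemma klein_form_scaleR: "klein_form (c *\<^sub>R x) = c\<^sup>2 * klein_form x"
  by (simp add: klein_form_def power2_eq_square algebra_simps)

lemma klein_form_polar [simp]: "klein_form (klein_polar x) = klein_form x"
  by (simp add: klein_form_def klein_polar_def)

lemma continuous_on_klein_form: "continuous_on S klein_form"
  unfolding klein_form_def by (intro continuous_intros)

text \<open>The combination of \<open>x\<close> and \<open>y\<close> is a multiple of
  \<open>z\<close>, hence null, and its form is \<open>a * b\<close> times the pairing of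
  \<open>x\<close> and \<open>y\<close>. Thus a circuit of three null vectors spans a totally
  isotropic plane.\<close>

lemma klein_isotropic_relation:
  assumes "klein_form x = 0" "klein_form y = 0" "klein_form z = 0"
    and "a *\<^sub>R x + b *\<^sub>R y + c *\<^sub>R z = 0" "a \<noteq> 0" "b \<noteq> 0"
  shows "x \<bullet> klein_polar y = 0"
proof -
  have "a *\<^sub>R x + b *\<^sub>R y = (- c) *\<^sub>R z" using assms(4) by (simp add: eq_neg_iff_add_eq_0)
  then have "klein_form (a *\<^sub>R x + b *\<^sub>R y) = 0" using assms(3) by (simp only: klein_form_scaleR)
  then show ?thesis using assms by (simp add: klein_form_add klein_form_scaleR klein_polar_scaleR)
qed

text \<open>By isotropy \<open>klein_polar u\<close> and \<open>klein_polar v\<close> are orthogonal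
  to \<open>u\<close> and \<open>v\<close>; being independent, they span the two-dimensional
  complement.\<close>

lemma isotropic_plane_complement:
  assumes ind: "\<forall>s t. s *\<^sub>R u + t *\<^sub>R v = 0 \<longrightarrow> s = 0 \<and> t = 0"
    and iso: "klein_form u = 0" "klein_form v = 0" "u \<bullet> klein_polar v = 0"
    and x: "u \<bullet> x = 0" "v \<bullet> x = 0"
  shows "\<exists>s t. x = s *\<^sub>R klein_polar u + t *\<^sub>R klein_polar v"
proof -
  define f where "f = (\<lambda>b. if b then u else v)"
  have UN: "(UNIV :: bool set) = {True, False}" by auto
  have f: "indep_family f UNIV" unfolding indep_family_def UN using ind by (auto simp: f_def)
  have g: "indep_family (\<lambda>b. klein_polar (f b)) UNIV"
    unfolding indep_family_def
  proof (intro allI impI)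
    fix e assume "(\<Sum>b\<in>UNIV. e b *\<^sub>R klein_polar (f b)) = 0"
    then have "klein_polar (\<Sum>b\<in>UNIV. e b *\<^sub>R klein_polar (f b)) = 0" by simp
    then have "(\<Sum>b\<in>UNIV. e b *\<^sub>R f b) = 0"
      by (simp add: UN klein_polar_add klein_polar_scaleR)
    then show "\<forall>b\<in>UNIV. e b = 0" using f by (simp add: indep_family_def)
  qed
  have "x \<in> span ((\<lambda>b. klein_polar (f b)) ` UNIV)"
    by (rule orthogonal_indep_families_span[OF _ f _ g])
       (use iso x in \<open>auto simp: f_def inner_klein_polar_self inner_klein_polar_commute[of v u]\<close>)
  from in_span_family[OF _ this] obtain e where "x = (\<Sum>b\<in>UNIV. e b *\<^sub>R klein_polar (f b))" by auto
  then have "x = e True *\<^sub>R klein_polar u + e False *\<^sub>R klein_polar v" by (simp add: UN f_def)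
  then show ?thesis by blast
qed

text \<open>A totally isotropic plane is its own complement for the polar form: the preceding
  description is applied to \<open>klein_polar x\<close>.\<close>

lemma isotropic_plane_complement_polar:
  assumes "\<forall>s t. s *\<^sub>R u + t *\<^sub>R v = 0 \<longrightarrow> s = 0 \<and> t = 0"
    and "klein_form u = 0" "klein_form v = 0" "u \<bullet> klein_polar v = 0"
    and "klein_polar u \<bullet> x = 0" "klein_polar v \<bullet> x = 0"
  shows "\<exists>s t. x = s *\<^sub>R u + t *\<^sub>R v"
proof -
  have "u \<bullet> klein_polar x = 0" "v \<bullet> klein_polar x = 0"
    using assms(5,6) by (simp_all add: inner_klein_polar_commute[of _ x] inner_commute[of x])
  from isotropic_plane_complement[OF assms(1-4) this] obtain s t
    where "klein_polar x = s *\<^sub>R klein_polar u + t *\<^sub>R klein_polar v" by blast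
  then have "klein_polar (klein_polar x) = klein_polar (s *\<^sub>R klein_polar u + t *\<^sub>R klein_polar v)" by simp
  then show ?thesis by (auto simp: klein_polar_add klein_polar_scaleR)
qed

text \<open>The complement, spanned by the images under \<open>klein_polar\<close>, is totally
  isotropic too. This excludes circuits of three when the cone is nontrivial.\<close>

lemma isotropic_plane_complement_null:
  assumes "\<forall>s t. s *\<^sub>R u + t *\<^sub>R v = 0 \<longrightarrow> s = 0 \<and> t = 0"
    and "klein_form u = 0" "klein_form v = 0" "u \<bullet> klein_polar v = 0" "u \<bullet> x = 0" "v \<bullet> x = 0"
  shows "klein_form x = 0"
  using isotropic_plane_complement[OF assms] assms(2-4)
  by (auto simp: klein_form_add klein_form_scaleR klein_polar_scaleR inner_commute[of "klein_polar u"] inner_klein_polar_commute)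

text \<open>Farkas represents \<open>- f a\<close> as a conic combination and Caratheodory makes it
  independent. If \<open>a\<close> occurred in it, the relation would be a nontrivial one inside
  \<open>B\<close>.\<close>

lemma positive_circuit:
  fixes f :: "'i \<Rightarrow> 'a::euclidean_space"
  assumes fin: "finite I" and cone: "dual_cone f I = {0}" and a: "f a \<noteq> 0"
  obtains B d where "B \<subseteq> I" "B \<noteq> {}" "a \<notin> B" "indep_family f B" "\<forall>b\<in>B. 0 < d b"
    "f a + (\<Sum>b\<in>B. d b *\<^sub>R f b) = 0" "card B \<le> DIM('a)"
proof -
  have "0 \<le> - f a \<bullet> x" if "x \<in> dual_cone f I" for x using that cone by simp
  from farkas_finite[OF fin this] obtain c
    where "\<forall>i\<in>I. 0 \<le> c i" "- f a = (\<Sum>i\<in>I. c i *\<^sub>R f i)" by blast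
  then obtain B d where B: "B \<subseteq> I" "indep_family f B" "\<And>b. b \<in> B \<Longrightarrow> 0 < d b"
    "- f a = (\<Sum>b\<in>B. d b *\<^sub>R f b)" using conic_caratheodory[OF fin, of c "- f a" f] by blast
  have finB: "finite B" using B(1) fin finite_subset by blast
  have rel: "f a + (\<Sum>b\<in>B. d b *\<^sub>R f b) = 0" using B(4) by (metis add.right_inverse)
  have "a \<notin> B"
  proof
    assume aB: "a \<in> B"
    define e where "e = d(a := d a + 1)"
    have "(\<Sum>b\<in>B. e b *\<^sub>R f b) = e a *\<^sub>R f a + (\<Sum>b\<in>B - {a}. e b *\<^sub>R f b)"
      using finB aB by (rule sum.remove)
    also have "(\<Sum>b\<in>B - {a}. e b *\<^sub>R f b) = (\<Sum>b\<in>B - {a}. d b *\<^sub>R f b)"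
      by (intro sum.cong) (auto simp: e_def)
    also have "e a *\<^sub>R f a + \<dots> = f a + (\<Sum>b\<in>B. d b *\<^sub>R f b)"
      using finB aB by (simp add: sum.remove[of B a] e_def scaleR_left_distrib)
    finally have "e a = 0" using rel B(2) aB by (auto simp: indep_family_def)
    then show False using B(3)[OF aB] by (simp add: e_def)
  qed
  moreover have "B \<noteq> {}" using rel a by auto
  ultimately show ?thesis using that[of B d] B rel card_indep_family_le_DIM[OF finB B(2)] by blast
qed

text \<open>Pairing the relation with \<open>x\<close> gives a vanishing sum of nonnegative
  terms.\<close>

lemma dual_cone_circuit:
  assumes "finite B" "0 < c" "\<And>b. b \<in> B \<Longrightarrow> 0 < d b" "c *\<^sub>R f a + (\<Sum>b\<in>B. d b *\<^sub>R f b) = 0"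
    "x \<in> dual_cone f (insert a B)"
  shows "f a \<bullet> x = 0" "\<And>b. b \<in> B \<Longrightarrow> f b \<bullet> x = 0"
proof -
  have z: "c * (f a \<bullet> x) + (\<Sum>b\<in>B. d b * (f b \<bullet> x)) = 0"
    using arg_cong[OF assms(4), of "\<lambda>v. v \<bullet> x"] by (simp add: inner_sum_left inner_add_left)
  have nn: "\<And>b. b \<in> B \<Longrightarrow> 0 \<le> d b * (f b \<bullet> x)" "0 \<le> c * (f a \<bullet> x)"
    using assms by (auto simp: dual_cone_def less_imp_le)
  then have s: "0 \<le> (\<Sum>b\<in>B. d b * (f b \<bullet> x))" by (intro sum_nonneg)
  show "f a \<bullet> x = 0" using z s nn(2) assms(2) by (smt (verit) mult_eq_0_iff)
  fix b assume b: "b \<in> B"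
  have "(\<Sum>b\<in>B. d b * (f b \<bullet> x)) = 0" using z s nn(2) by linarith
  then have "d b * (f b \<bullet> x) = 0"
    using nn(1) assms(1) b sum_nonneg_eq_0_iff[of B "\<lambda>b. d b * (f b \<bullet> x)"] by blast
  then show "f b \<bullet> x = 0" using assms(3)[OF b] by simp
qed

text \<open>One constraint negative and one positive on \<open>t\<close> together cut off the line
  through \<open>t\<close>.\<close>

lemma dual_cone_separating_pair:
  fixes f :: "'i \<Rightarrow> 'a::real_inner"
  assumes "t \<notin> dual_cone f I" "- t \<notin> dual_cone f I"
  obtains i j where "i \<in> I" "j \<in> I"
    "\<And>s. s *\<^sub>R t \<in> dual_cone f {i, j} \<Longrightarrow> s = 0"
proof -
  obtain i j where ij: "i \<in> I" "f i \<bullet> t < 0" "j \<in> I" "0 < f j \<bullet> t"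
    using assms by (auto simp: dual_cone_def not_le)
  show ?thesis
  proof (rule that[OF ij(1,3)])
    fix s assume "s *\<^sub>R t \<in> dual_cone f {i, j}"
    then have "0 \<le> s * (f i \<bullet> t)" "0 \<le> s * (f j \<bullet> t)" by (auto simp: dual_cone_def)
    then show "s = 0" using ij by (auto simp: zero_le_mult_iff)
  qed
qed

lemma plane_orthogonal_zero:
  fixes p r y :: "real \<times> real"
  assumes "fst p * snd r - snd p * fst r \<noteq> 0" "p \<bullet> y = 0" "r \<bullet> y = 0"
  shows "y = 0"
proof -
  have "(fst p * snd r - snd p * fst r) * fst y = snd r * (p \<bullet> y) - snd p * (r \<bullet> y)"
    "(fst p * snd r - snd p * fst r) * snd y = fst p * (r \<bullet> y) - fst r * (p \<bullet> y)"
    by (simp_all add: inner_prod_def algebra_simps)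
  then show ?thesis using assms by (auto simp: prod_eq_iff)
qed

lemma corank_one_orthogonal_line:
  fixes f :: "'i \<Rightarrow> 'a::euclidean_space"
  assumes "finite B" "indep_family f B" "card B + 1 = DIM('a)"
  obtains t where "t \<noteq> 0" "\<And>b. b \<in> B \<Longrightarrow> f b \<bullet> t = 0"
    "\<And>x. (\<And>b. b \<in> B \<Longrightarrow> f b \<bullet> x = 0) \<Longrightarrow> \<exists>s. x = s *\<^sub>R t"
proof -
  have "dim (f ` B) \<le> card (f ` B)" using assms(1) by (intro dim_le_card') auto
  also have "\<dots> \<le> card B" using assms(1) by (rule card_image_le)
  finally have "dim (f ` B) < DIM('a)" using assms(3) by simp
  then obtain t where t: "t \<noteq> 0" "\<And>y. y \<in> span (f ` B) \<Longrightarrow> orthogonal t y"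
    using orthogonal_to_subspace_exists by metis
  have ft: "f b \<bullet> t = 0" if "b \<in> B" for b
    using t(2)[of "f b"] that by (simp add: span_base orthogonal_def inner_commute)
  have "\<exists>s. x = s *\<^sub>R t" if x: "\<And>b. b \<in> B \<Longrightarrow> f b \<bullet> x = 0" for x
  proof -
    have "indep_family id {t}" using t(1) by (simp add: indep_family_def)
    then have "x \<in> span (id ` {t})"
      by (intro orthogonal_indep_families_span[OF assms(1,2)]) (use assms(3) ft x in auto)
    then show ?thesis by (auto simp: span_singleton)
  qed
  then show ?thesis using that t(1) ft by blast
qed

section \<open>Pairwise nonproportional null vectors with trivial dual cone: six suffice\<close>

context
  fixes f :: "'i \<Rightarrow> quad" and I :: "'i set"
  assumes fin: "finite I" and null: "\<And>i. i \<in> I \<Longrightarrow> klein_form (f i) = 0"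
    and nonzero: "\<And>i. i \<in> I \<Longrightarrow> f i \<noteq> 0"
    and nonpar: "\<And>i j c. i \<in> I \<Longrightarrow> j \<in> I \<Longrightarrow> i \<noteq> j \<Longrightarrow> f i \<noteq> c *\<^sub>R f j"
    and cone: "dual_cone f I = {0}"
begin

text \<open>The triangle \<open>a\<close>, \<open>b\<close>, \<open>c\<close> spans an isotropic
  plane and confines its dual cone to the complement, where only classes modulo the plane matter.
  These positively span a two-dimensional quotient. A circuit of three there plus the triangle gives
  six; two opposite pairs plus the triangle would give seven, so one triangle element is saved by
  lifting the pair relations to the original space.\<close>

lemma positive_spanning_null_triangle:
  assumes abc: "a \<in> I" "b \<in> I" "c \<in> I" "b \<noteq> c" "a \<noteq> b" "a \<noteq> c"
    and ind: "\<forall>s t. s *\<^sub>R f b + t *\<^sub>R f c = 0 \<longrightarrow> s = 0 \<and> t = 0"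
    and d: "0 < d1" "0 < d2" "f a + d1 *\<^sub>R f b + d2 *\<^sub>R f c = 0"
  shows "\<exists>J\<subseteq>I. card J \<le> 6 \<and> dual_cone f J = {0}"
proof -
  let ?G = "{a, b, c}"
  define u where "u = f b"
  define v where "v = f c"
  have iso: "klein_form u = 0" "klein_form v = 0" "u \<bullet> klein_polar v = 0"
    using null abc klein_isotropic_relation[of "f b" "f c" "f a" d1 d2 1] d
    by (simp_all add: u_def v_def add.commute add.left_commute)
  note ind' = ind[folded u_def v_def]
  note compl = isotropic_plane_complement[OF ind' iso]
  define g where "g = (\<lambda>i. (f i \<bullet> klein_polar u, f i \<bullet> klein_polar v))"
  text \<open>\<open>g\<close> is \<open>f\<close> modulo the isotropic plane spanned by \<open>u\<close> and \<open>v\<close>; \<open>emb\<close> is the dual embedding.\<close>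
  define emb where "emb = (\<lambda>y. fst y *\<^sub>R klein_polar u + snd y *\<^sub>R klein_polar v)" for y :: "real \<times> real"
  have f_emb: "f i \<bullet> emb y = g i \<bullet> y" for i y
    by (simp add: emb_def g_def inner_prod_def inner_add_right algebra_simps)
  have emb0: "y = 0" if "emb y = 0" for y
  proof -
    have "klein_polar (emb y) = 0" using that by simp
    then show ?thesis using ind'[rule_format, of "fst y" "snd y"]
      by (simp add: emb_def klein_polar_add klein_polar_scaleR prod_eq_iff)
  qed
  have emb: "\<exists>y. x = emb y" if "u \<bullet> x = 0" "v \<bullet> x = 0" for x
    using compl[OF that] by (force simp: emb_def)
  have gcone: "dual_cone g I = {0}"
  proof -
    have "y = 0" if "y \<in> dual_cone g I" for y
    proof -
      have "emb y \<in> dual_cone f I" using that by (simp add: dual_cone_def f_emb)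
      then show ?thesis using cone emb0 by blast
    qed
    then show ?thesis by auto
  qed
  have G: "f i \<bullet> x = 0" if "i \<in> ?G" "u \<bullet> x = 0" "v \<bullet> x = 0" for i x
    using that arg_cong[OF d(3), of "\<lambda>w. w \<bullet> x"] by (auto simp: u_def v_def inner_add_left)
  have coneG: "u \<bullet> x = 0" "v \<bullet> x = 0" if "x \<in> dual_cone f S" "?G \<subseteq> S" for x S
  proof -
    have nn: "0 \<le> f a \<bullet> x" "0 \<le> u \<bullet> x" "0 \<le> v \<bullet> x" using that by (auto simp: dual_cone_def u_def v_def)
    have "f a \<bullet> x + d1 * (u \<bullet> x) + d2 * (v \<bullet> x) = 0"
      using arg_cong[OF d(3), of "\<lambda>w. w \<bullet> x"] by (simp add: u_def v_def inner_add_left)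
    moreover have "0 \<le> d1 * (u \<bullet> x)" "0 \<le> d2 * (v \<bullet> x)" using nn d by auto
    ultimately have "d1 * (u \<bullet> x) = 0" "d2 * (v \<bullet> x) = 0" using nn by linarith+
    then show "u \<bullet> x = 0" "v \<bullet> x = 0" using d by auto
  qed
  \<comment> \<open>Any two elements of the triangle span the isotropic plane, so the third may be
    dropped once these two vanish on \<open>x\<close>.\<close>
  have two: "u \<bullet> x = 0 \<and> v \<bullet> x = 0"
    if "M \<subseteq> ?G" "card M = 2" "\<And>m. m \<in> M \<Longrightarrow> f m \<bullet> x = 0" for M x
  proof -
    have r: "f a \<bullet> x + d1 * (u \<bullet> x) + d2 * (v \<bullet> x) = 0"
      using arg_cong[OF d(3), of "\<lambda>w. w \<bullet> x"] by (simp add: u_def v_def inner_add_left)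
    obtain k l where M: "M = {k, l}" "k \<noteq> l" using \<open>card M = 2\<close> by (auto simp: card_2_iff)
    have "f k \<bullet> x = 0" "f l \<bullet> x = 0" "k \<in> ?G" "l \<in> ?G" using that M by auto
    then show ?thesis using r M(2) d(1,2) by (auto simp: u_def v_def)
  qed
  have three: ?thesis
    if P: "P \<subseteq> I" "p \<in> I" "indep_family g P" "\<forall>b\<in>P. 0 < e b"
      "g p + (\<Sum>b\<in>P. e b *\<^sub>R g b) = 0" "card P = 2" for p P e
  proof (intro exI conjI)
    let ?J = "?G \<union> insert p P"
    have finP: "finite P" using P(1) fin finite_subset by blast
    show "?J \<subseteq> I" using abc P by auto
    show "card ?J \<le> 6"
      using card_Un_le[of ?G "insert p P"] card_insert_le_m1[of 3 P p] P(6) abc by simp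
    have "x = 0" if x: "x \<in> dual_cone f ?J" for x
    proof -
      obtain y where y: "x = emb y" using emb[of x] coneG[OF x] by blast
      have "y \<in> dual_cone g (insert p P)" using x by (auto simp: dual_cone_def y f_emb)
      then have "g b \<bullet> y = 0" if "b \<in> P" for b
        using dual_cone_circuit(2)[OF finP, of 1 e g p y] P(4,5) that by simp
      then have "y = 0"
        using indep_family_orthogonal_imp_zero[OF finP P(3)] P(6) by simp
      then show ?thesis by (simp add: y emb_def)
    qed
    then show "dual_cone f ?J = {0}" by auto
  qed
  \<comment> \<open>Two opposite pairs in different directions of the quotient and only two triangle
    elements \<open>M\<close>; the last premise asks that these still vanish on the whole
    cone.\<close>
  have four: ?thesis
    if pq: "p \<in> I" "q \<in> I" "0 < e" "g p + e *\<^sub>R g q = 0" and rs: "r \<in> I" "s \<in> I" "0 < e'" "g r + e' *\<^sub>R g s = 0"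
      and det: "fst (g p) * snd (g r) - snd (g p) * fst (g r) \<noteq> 0"
      and M: "M \<subseteq> ?G" "card M = 2" "\<And>x m. x \<in> dual_cone f ({p,q,r,s} \<union> M) \<Longrightarrow> m \<in> M \<Longrightarrow> f m \<bullet> x = 0"
    for p q r s e e' M
  proof (intro exI conjI)
    let ?J = "{p,q,r,s} \<union> M"
    show "?J \<subseteq> I" using abc pq rs M by auto
    have "card {p,q,r,s} \<le> 4" by (simp add: card_insert_if)
    then show "card ?J \<le> 6" using card_Un_le[of "{p,q,r,s}" M] M(2) by linarith
    have "x = 0" if x: "x \<in> dual_cone f ?J" for x
    proof -
      obtain y where y: "x = emb y" using emb two[OF M(1,2)] M(3)[OF x] by blast
      have nn: "0 \<le> g i \<bullet> y" if "i \<in> {p,q,r,s}" for i using x that by (auto simp: dual_cone_def y f_emb)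
      have "g p \<bullet> y = 0"
        using dual_cone_circuit(1)[of "{q}" 1 "\<lambda>_. e" g p y] pq nn by (auto simp: dual_cone_def)
      moreover have "g r \<bullet> y = 0"
        using dual_cone_circuit(1)[of "{s}" 1 "\<lambda>_. e'" g r y] rs nn by (auto simp: dual_cone_def)
      ultimately have "y = 0" using plane_orthogonal_zero det by blast
      then show ?thesis by (simp add: y emb_def)
    qed
    then show "dual_cone f ?J = {0}" by auto
  qed
  \<comment> \<open>The relation of an opposite pair lifts: \<open>w\<close> lies in the isotropic
    plane because this plane is its own polar complement, and the triangle spans it positively.
    \<open>K\<close> is nonempty because \<open>f p\<close> and \<open>f q\<close> are not
    proportional.\<close>
  have rep: "\<exists>K k. K \<subseteq> ?G \<and> (\<forall>i\<in>K. 0 < k i) \<and> f p + e *\<^sub>R f q + (\<Sum>i\<in>K. k i *\<^sub>R f i) = 0 \<and> K \<noteq> {} \<and> card K \<le> 2"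
    if pq: "p \<in> I" "q \<in> I" "p \<noteq> q" "g p + e *\<^sub>R g q = 0" for p q e
  proof -
    define w where "w = - (f p + e *\<^sub>R f q)"
    have "w \<bullet> klein_polar u = fst (- (g p + e *\<^sub>R g q))" "w \<bullet> klein_polar v = snd (- (g p + e *\<^sub>R g q))"
      by (simp_all add: w_def g_def inner_diff_left inner_add_left)
    then have wJ: "klein_polar u \<bullet> w = 0" "klein_polar v \<bullet> w = 0"
      using pq(4) by (simp_all add: inner_commute)
    obtain s t where w: "w = s *\<^sub>R u + t *\<^sub>R v"
      using isotropic_plane_complement_polar[OF ind' iso wJ] by blast
    have "0 \<le> w \<bullet> x" if "x \<in> dual_cone f ?G" for x using coneG[OF that] by (simp add: w inner_add_left)
    then obtain k0 where k0: "\<forall>i\<in>?G. 0 \<le> k0 i" "w = (\<Sum>i\<in>?G. k0 i *\<^sub>R f i)"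
      using farkas_finite[of ?G f w] by blast
    have finG: "finite ?G" by simp
    then obtain K k where K: "K \<subseteq> ?G" "indep_family f K" "\<And>i. i \<in> K \<Longrightarrow> 0 < k i"
      "w = (\<Sum>i\<in>K. k i *\<^sub>R f i)" using conic_caratheodory[OF finG, of k0 w f] k0 by blast
    have finK: "finite K" using K(1) finite_subset by blast
    have "f a = - (d1 *\<^sub>R u + d2 *\<^sub>R v)"
      using d(3) by (simp only: u_def v_def eq_neg_iff_add_eq_0 add.assoc)
    then have "f a \<in> span {u, v}"
      by (simp only: span_neg span_add span_mul span_base insertI1 insertI2)
    then have "f ` K \<subseteq> span {u, v}" using K(1) by (auto simp: u_def v_def span_base)
    then have "card K \<le> dim (span {u, v})" by (rule card_indep_family_le_dim[OF finK K(2)])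
    also have "\<dots> \<le> 2" using dim_le_card'[of "{u, v}"] by (simp add: card_insert_if split: if_splits)
    finally have "card K \<le> 2" .
    moreover have rel: "f p + e *\<^sub>R f q + (\<Sum>i\<in>K. k i *\<^sub>R f i) = 0" by (simp flip: K(4)) (simp add: w_def)
    moreover have "K \<noteq> {}"
    proof
      assume "K = {}"
      then have "f p = (- e) *\<^sub>R f q" using rel by (simp add: eq_neg_iff_add_eq_0)
      then show False using nonpar pq by blast
    qed
    ultimately show ?thesis using K by blast
  qed
  \<comment> \<open>The lifted relation has positive coefficients, so its triangle part vanishes on
    the cone even if the full triangle is not present.\<close>
  have relK: "f i \<bullet> x = 0"
    if "K \<subseteq> ?G" "\<forall>i\<in>K. 0 < k i" "f p + e *\<^sub>R f q + (\<Sum>i\<in>K. k i *\<^sub>R f i) = 0" "0 < e"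
      "x \<in> dual_cone f S" "{p, q} \<union> K \<subseteq> S" "i \<in> K" for K k p q e x i S
  proof -
    have "finite K" using that(1) finite_subset by blast
    have nn: "0 \<le> f j \<bullet> x" if "j \<in> {p, q} \<union> K" for j using \<open>x \<in> _\<close> \<open>_ \<subseteq> S\<close> that by (auto simp: dual_cone_def)
    have "f p \<bullet> x + e * (f q \<bullet> x) + (\<Sum>i\<in>K. k i * (f i \<bullet> x)) = 0"
      using arg_cong[OF that(3), of "\<lambda>w. w \<bullet> x"] by (simp add: inner_add_left inner_sum_left)
    moreover have "0 \<le> e * (f q \<bullet> x)" "0 \<le> f p \<bullet> x" using nn that(4) by auto
    moreover have nnK: "\<And>i. i \<in> K \<Longrightarrow> 0 \<le> k i * (f i \<bullet> x)" using nn that(2) by (simp add: less_imp_le)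
    moreover have "0 \<le> (\<Sum>i\<in>K. k i * (f i \<bullet> x))" using nnK by (rule sum_nonneg)
    ultimately have "(\<Sum>i\<in>K. k i * (f i \<bullet> x)) = 0" by linarith
    then have "k i * (f i \<bullet> x) = 0"
      using nnK \<open>finite K\<close> that(7) sum_nonneg_eq_0_iff[of K "\<lambda>i. k i * (f i \<bullet> x)"] by blast
    then show ?thesis using that(2,7) by auto
  qed
  have "\<exists>p\<in>I. g p \<noteq> 0"
  proof (rule ccontr)
    assume "\<not> ?thesis"
    then have "(1, 0) \<in> dual_cone g I" by (simp add: dual_cone_def)
    then show False unfolding gcone by (simp add: zero_prod_def)
  qed
  then obtain p where p: "p \<in> I" "g p \<noteq> 0" by blast
  obtain P e where P: "P \<subseteq> I" "P \<noteq> {}" "p \<notin> P" "indep_family g P" "\<forall>b\<in>P. 0 < e b"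
    "g p + (\<Sum>b\<in>P. e b *\<^sub>R g b) = 0" "card P \<le> DIM(real \<times> real)"
    by (rule positive_circuit[OF fin gcone p(2)]) blast
  \<comment> \<open>Otherwise \<open>g p\<close> turned by a right angle would be orthogonal to all
    \<open>g i\<close> and lie in their dual cone.\<close>
  have "\<exists>r\<in>I. fst (g p) * snd (g r) - snd (g p) * fst (g r) \<noteq> 0"
  proof (rule ccontr)
    assume n: "\<not> ?thesis"
    have "g i \<bullet> (- snd (g p), fst (g p)) = fst (g p) * snd (g i) - snd (g p) * fst (g i)" for i
      by (simp add: inner_prod_def)
    then have "(- snd (g p), fst (g p)) \<in> dual_cone g I" using n by (simp add: dual_cone_def)
    then show False using p(2) unfolding gcone by (auto simp: prod_eq_iff)
  qed
  then obtain r where r: "r \<in> I" "fst (g p) * snd (g r) - snd (g p) * fst (g r) \<noteq> 0" by blast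
  have "g r \<noteq> 0" using r(2) by auto
  then obtain R e' where R: "R \<subseteq> I" "R \<noteq> {}" "r \<notin> R" "indep_family g R" "\<forall>b\<in>R. 0 < e' b"
    "g r + (\<Sum>b\<in>R. e' b *\<^sub>R g b) = 0" "card R \<le> DIM(real \<times> real)"
    by (rule positive_circuit[OF fin gcone]) blast
  have finPR: "finite P" "finite R" using P(1) R(1) fin finite_subset by blast+
  show ?thesis
  proof (cases "card P = 2 \<or> card R = 2")
    case True
    then show ?thesis using three[OF P(1) p(1) P(4-6)] three[OF R(1) r(1) R(4-6)] by blast
  next
    case False
    then have "card P = 1" "card R = 1" using P(2,7) R(2,7) finPR card_gt_0_iff[of P] card_gt_0_iff[of R] by auto
    then obtain q s where qs: "P = {q}" "R = {s}" by (meson card_1_singletonE)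
    have pq: "p \<in> I" "q \<in> I" "0 < e q" "g p + e q *\<^sub>R g q = 0" "p \<noteq> q" using P p qs by auto
    have rs: "r \<in> I" "s \<in> I" "0 < e' s" "g r + e' s *\<^sub>R g s = 0" "r \<noteq> s" using R r qs by auto
    obtain K k where K: "K \<subseteq> ?G" "\<forall>i\<in>K. 0 < k i" "f p + e q *\<^sub>R f q + (\<Sum>i\<in>K. k i *\<^sub>R f i) = 0" "K \<noteq> {}" "card K \<le> 2"
      using rep[OF pq(1,2,5,4)] by blast
    obtain L l where L: "L \<subseteq> ?G" "\<forall>i\<in>L. 0 < l i" "f r + e' s *\<^sub>R f s + (\<Sum>i\<in>L. l i *\<^sub>R f i) = 0" "L \<noteq> {}" "card L \<le> 2"
      using rep[OF rs(1,2,5,4)] by blast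
    note four' = four[OF pq(1-4) rs(1-4) r(2)]
    have finKL: "finite K" "finite L" using K(1) L(1) finite_subset by blast+
    \<comment> \<open>If one lifted relation uses two triangle elements, these serve as
      \<open>M\<close>; two single elements serve if they differ.\<close>
    consider "card K = 2" | "card L = 2" | "card K = 1" "card L = 1"
      using K(4,5) L(4,5) finKL card_gt_0_iff[of K] card_gt_0_iff[of L] by linarith
    then show ?thesis
    proof cases
      case 1
      show ?thesis by (rule four'[OF K(1) 1]) (rule relK[OF K(1-3) pq(3)], auto)
    next
      case 2
      show ?thesis by (rule four'[OF L(1) 2]) (rule relK[OF L(1-3) rs(3)], auto)
    next
      case 3
      then obtain m n where mn: "K = {m}" "L = {n}" by (meson card_1_singletonE)
      show ?thesis
      proof (cases "m = n")
        case False
        show ?thesis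
        proof (rule four'[of "{m, n}"])
          show "{m, n} \<subseteq> ?G" "card {m, n} = 2" using K(1) L(1) mn False by auto
          fix x i assume x: "x \<in> dual_cone f ({p,q,r,s} \<union> {m,n})" "i \<in> {m,n}"
          have "f m \<bullet> x = 0" by (rule relK[OF K(1-3) pq(3) x(1)]) (auto simp: mn)
          moreover have "f n \<bullet> x = 0" by (rule relK[OF L(1-3) rs(3) x(1)]) (auto simp: mn)
          ultimately show "f i \<bullet> x = 0" using x(2) by auto
        qed
      next
        case True
        text \<open>Now \<open>f m\<close> lies in the isotropic planes through \<open>f p\<close>, through \<open>f r\<close> and through \<open>u\<close>, \<open>v\<close>.
          These together span the space, so \<open>f m\<close> is in the radical of the nondegenerate form.\<close>
        have mI: "m \<in> ?G" "m \<in> I" using K(1) mn abc by auto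
        have km: "0 < k m" "0 < l m" using K(2) L(2) mn True by auto
        have "f p \<bullet> klein_polar (f m) = 0"
          using klein_isotropic_relation[of "f p" "f m" "f q" 1 "k m" "e q"] null mI pq K(3) km
          by (simp add: mn add.commute add.left_commute)
        moreover have "f r \<bullet> klein_polar (f m) = 0"
          using klein_isotropic_relation[of "f r" "f m" "f s" 1 "l m" "e' s"] null mI rs L(3) km
          by (simp add: mn True[symmetric] add.commute add.left_commute)
        moreover have "u \<bullet> klein_polar (f m) = 0" "v \<bullet> klein_polar (f m) = 0"
        proof -
          have "f m \<bullet> klein_polar u = 0" "f m \<bullet> klein_polar v = 0"
            using G[OF mI(1), of "klein_polar u"] G[OF mI(1), of "klein_polar v"] iso
            by (simp_all add: inner_klein_polar_self inner_klein_polar_commute[of v u])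
          then show "u \<bullet> klein_polar (f m) = 0" "v \<bullet> klein_polar (f m) = 0"
            by (simp_all add: inner_klein_polar_commute[of _ "f m"])
        qed
        moreover obtain y where y: "klein_polar (f m) = emb y" using emb calculation(3,4) by blast
        ultimately have "g p \<bullet> y = 0" "g r \<bullet> y = 0" by (simp_all flip: f_emb)
        then have "y = 0" using plane_orthogonal_zero r(2) by blast
        then have "klein_polar (f m) = 0" by (simp add: y emb_def)
        then have "f m = 0" by (metis klein_polar_polar klein_polar_0)
        then show ?thesis using nonzero mI by blast
      qed
    qed
  qed
qed

text \<open>The circuit through an arbitrary \<open>a\<close> has two to five elements. Two are
  excluded by nonproportionality, three is the triangle case, four leave a line that two further
  constraints cut off, and five have trivial dual cone.\<close>

lemma positive_spanning_null_card_le_6: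
  "\<exists>J\<subseteq>I. card J \<le> 6 \<and> dual_cone f J = {0}"
proof -
  have "I \<noteq> {}"
  proof
    assume "I = {}"
    then have "((1,0),0) \<in> dual_cone f I" by (simp add: dual_cone_def)
    then show False using cone by (auto simp: zero_prod_def)
  qed
  then obtain a where a: "a \<in> I" by blast
  obtain B d where B: "B \<subseteq> I" "B \<noteq> {}" "a \<notin> B" "indep_family f B" "\<forall>b\<in>B. 0 < d b"
    "f a + (\<Sum>b\<in>B. d b *\<^sub>R f b) = 0" "card B \<le> DIM(quad)"
    by (rule positive_circuit[OF fin cone nonzero[OF a]]) blast
  have finB: "finite B" using B(1) fin finite_subset by blast
  have aB: "f b \<bullet> x = 0" if "x \<in> dual_cone f (insert a B \<union> S)" "b \<in> B" for x b S
    using dual_cone_circuit(2)[OF finB, of 1 d f a x b] B(5,6) that by (auto simp: dual_cone_def)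
  have "card B > 0" using B(2) finB by (simp add: card_gt_0_iff)
  then consider "card B = 1" | "card B = 2" | "card B = 3" | "card B = 4" using B(7) by (simp; linarith)
  then show ?thesis
  proof cases
    case 1
    then obtain b where "B = {b}" by (meson card_1_singletonE)
    then have "f a = (- d b) *\<^sub>R f b" using B(6) by (simp add: eq_neg_iff_add_eq_0)
    then show ?thesis using nonpar[OF a, of b] B(1,3) \<open>B = {b}\<close> by blast
  next
    case 2
    then obtain b c where bc: "B = {b, c}" "b \<noteq> c" by (auto simp: card_2_iff)
    show ?thesis
    proof (rule positive_spanning_null_triangle[of a b c "d b" "d c"])
      have "s = 0 \<and> t = 0" if "s *\<^sub>R f b + t *\<^sub>R f c = 0" for s t
      proof -
        from that have "(\<Sum>j\<in>B. (if j = b then s else t) *\<^sub>R f j) = 0" using bc by simp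
        then have "\<forall>j\<in>B. (if j = b then s else t) = 0" using B(4) unfolding indep_family_def
        by (elim allE[of _ "\<lambda>j. if j = b then s else t"]) simp
        then show ?thesis using bc by (auto split: if_splits)
      qed
      then show "\<forall>s t. s *\<^sub>R f b + t *\<^sub>R f c = 0 \<longrightarrow> s = 0 \<and> t = 0" by blast
    qed (use a B bc in \<open>auto simp: add.assoc\<close>)
  next
    case 3
    obtain t where t: "t \<noteq> 0" "\<And>b. b \<in> B \<Longrightarrow> f b \<bullet> t = 0"
      "\<And>x. (\<And>b. b \<in> B \<Longrightarrow> f b \<bullet> x = 0) \<Longrightarrow> \<exists>s. x = s *\<^sub>R t"
      by (rule corank_one_orthogonal_line[OF finB B(4)]) (use 3 in auto)
    obtain i j where ij: "i \<in> I" "j \<in> I" "\<And>s. s *\<^sub>R t \<in> dual_cone f {i, j} \<Longrightarrow> s = 0"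
      by (rule dual_cone_separating_pair[of t f I]) (use cone t(1) in auto)
    have "card (insert a B \<union> {i, j}) \<le> 6"
      using card_Un_le[of "insert a B" "{i, j}"] 3 B(3) finB by (auto simp: card_insert_if split: if_splits)
    moreover have "x = 0" if x: "x \<in> dual_cone f (insert a B \<union> {i, j})" for x
    proof -
      obtain s where s: "x = s *\<^sub>R t" using t(3) aB[OF x] by blast
      have "s *\<^sub>R t \<in> dual_cone f {i, j}" using x by (simp add: dual_cone_def s)
      then show ?thesis using ij(3) s by simp
    qed
    ultimately show ?thesis using a B(1) ij
      by (intro exI[of _ "insert a B \<union> {i, j}"]) auto
  next
    case 4
    have "x = 0" if x: "x \<in> dual_cone f (insert a B \<union> {})" for x
      by (rule indep_family_orthogonal_imp_zero[OF finB B(4)]) (use 4 aB[OF x] in auto)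
    then have "dual_cone f (insert a B) = {0}" by auto
    then show ?thesis using a B(1,3) 4 finB by (intro exI[of _ "insert a B"]) auto
  qed
qed

end

section \<open>The case of a nontrivial cone: Farkas certificates and opposite pairs\<close>

section \<open>One-sided systems\<close>

text \<open>The hypotheses make \<open>a\<close> null, so \<open>klein_polar a\<close> lies in the
  hyperplane orthogonal to \<open>a\<close> and spans the radical of the form restricted to it.
  Modulo the radical the form has signature (1,1), so it splits into two linear factors vanishing on
  the radical.\<close>

lemma null_hyperplane_factorization:
  fixes a :: quad
  assumes n: "fst a \<noteq> 0" and rank: "snd a = \<mu> *\<^sub>R fst a"
  obtains \<phi> \<psi> r :: quad where "r \<noteq> 0" "a \<bullet> r = 0" "\<phi> \<bullet> r = 0" "\<psi> \<bullet> r = 0"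
    "\<And>x. a \<bullet> x = 0 \<Longrightarrow> klein_form x = - ((\<phi> \<bullet> x) * (\<psi> \<bullet> x))"
    "\<And>x. a \<bullet> x = 0 \<Longrightarrow> \<phi> \<bullet> x = 0 \<Longrightarrow> \<psi> \<bullet> x = 0 \<Longrightarrow> \<exists>s. x = s *\<^sub>R r"
proof -
  obtain n1 n2 where n12: "fst a = (n1, n2)" by fastforce
  have a: "a = ((n1, n2), (\<mu> * n1, \<mu> * n2))" using n12 rank by (simp add: prod_eq_iff)
  define N where "N = n1\<^sup>2 + n2\<^sup>2"
  have N: "N > 0" using n n12 unfolding N_def by (simp add: zero_prod_def sum_power2_gt_zero_iff)
  define \<phi> :: quad where "\<phi> = ((- n2, n1), (- \<mu> * n2, \<mu> * n1))"
  define \<psi> :: quad where "\<psi> = ((0, 0), (n1 / N, n2 / N))"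
  \<comment> \<open>This is \<open>klein_polar a\<close>.\<close>
  define r :: quad where "r = ((\<mu> * n2, - \<mu> * n1), (- n2, n1))"
  show thesis
  proof
    show "r \<noteq> 0" using n n12 by (auto simp: r_def zero_prod_def)
    show "a \<bullet> r = 0" "\<phi> \<bullet> r = 0" "\<psi> \<bullet> r = 0"
      by (simp_all add: a r_def \<phi>_def \<psi>_def inner_prod_def algebra_simps)
  next
    fix x :: quad
    assume ax: "a \<bullet> x = 0"
    obtain u1 u2 w1 w2 where x: "x = ((u1, u2), (w1, w2))" by (metis prod.exhaust)
    \<comment> \<open>\<open>y1\<close> and \<open>y2\<close> give the position of the line
      \<open>x\<close> at height \<open>\<mu>\<close>; the hyperplane condition makes it orthogonal
      to the vector with entries \<open>n1\<close>, \<open>n2\<close>.\<close>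
    define y1 where "y1 = u1 + \<mu> * w1"
    define y2 where "y2 = u2 + \<mu> * w2"
    have y: "n1 * y1 + n2 * y2 = 0"
      using ax by (simp add: a x y1_def y2_def inner_prod_def algebra_simps)
    have k: "klein_form x = y1 * w2 - y2 * w1"
      by (simp add: klein_form_def x y1_def y2_def algebra_simps)
    have \<phi>: "\<phi> \<bullet> x = n1 * y2 - n2 * y1"
      by (simp add: \<phi>_def x y1_def y2_def inner_prod_def algebra_simps)
    have \<psi>: "N * (\<psi> \<bullet> x) = n1 * w1 + n2 * w2"
      using N by (simp add: \<psi>_def x inner_prod_def distrib_left)
    have "N * klein_form x = - ((n1 * y2 - n2 * y1) * (n1 * w1 + n2 * w2))
        + (n1 * y1 + n2 * y2) * (n1 * w2 - n2 * w1)"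
      by (simp add: N_def k algebra_simps power2_eq_square)
    then have "N * klein_form x = N * - ((\<phi> \<bullet> x) * (\<psi> \<bullet> x))"
      using y \<phi> by (simp add: mult.left_commute[of N] \<psi>)
    then show "klein_form x = - ((\<phi> \<bullet> x) * (\<psi> \<bullet> x))" using N by (metis less_irrefl mult_cancel_left)
    assume "\<phi> \<bullet> x = 0" "\<psi> \<bullet> x = 0"
    then have z: "n1 * y2 - n2 * y1 = 0" "n1 * w1 + n2 * w2 = 0" using \<phi> \<psi> by auto
    have "N * y1 = n1 * (n1 * y1 + n2 * y2) - n2 * (n1 * y2 - n2 * y1)"
      "N * y2 = n2 * (n1 * y1 + n2 * y2) + n1 * (n1 * y2 - n2 * y1)"
      by (simp_all add: N_def algebra_simps power2_eq_square)
    then have "N * y1 = 0" "N * y2 = 0" unfolding y z(1) by simp_all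
    then have "y1 = 0" "y2 = 0" using N by simp_all
    then have y0: "u1 = - \<mu> * w1" "u2 = - \<mu> * w2" unfolding y1_def y2_def by linarith+
    define s where "s = (n1 * w2 - n2 * w1) / N"
    have "N * w1 = n1 * (n1 * w1 + n2 * w2) - n2 * (n1 * w2 - n2 * w1)"
      "N * w2 = n2 * (n1 * w1 + n2 * w2) + n1 * (n1 * w2 - n2 * w1)"
      by (simp_all add: N_def algebra_simps power2_eq_square)
    then have "N * w1 = - (n2 * (N * s))" "N * w2 = n1 * (N * s)"
      unfolding z(2) using N by (simp_all add: s_def)
    then have "N * w1 = N * - (s * n2)" "N * w2 = N * (s * n1)" by (simp_all add: ac_simps)
    then have w: "w1 = - (s * n2)" "w2 = s * n1" using N by (metis less_irrefl mult_cancel_left)+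
    have "x = s *\<^sub>R r" by (simp add: x r_def y0 w)
    then show "\<exists>s. x = s *\<^sub>R r" ..
  qed
qed

text \<open>The cone meets the unit sphere in a compact set, where \<open>v\<close> attains a
  positive minimum; homogeneity extends the bound.\<close>

lemma dual_cone_positive_functional_bound:
  fixes f :: "'i \<Rightarrow> 'a::euclidean_space"
  assumes pos: "\<And>x. x \<in> dual_cone f I \<Longrightarrow> x \<noteq> 0 \<Longrightarrow> 0 < v \<bullet> x"
  obtains e where "0 < e" "\<And>x. x \<in> dual_cone f I \<Longrightarrow> e * norm x \<le> v \<bullet> x"
proof (cases "dual_cone f I \<inter> sphere 0 1 = {}")
  case True
  have "x = 0" if "x \<in> dual_cone f I" for x
  proof (rule ccontr)
    assume "x \<noteq> 0"
    then have "x /\<^sub>R norm x \<in> dual_cone f I \<inter> sphere 0 1"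
      using that by (simp add: dual_cone_scale)
    with True show False by blast
  qed
  then show ?thesis using that[of 1] by force
next
  case False
  have "dual_cone f I = (\<Inter>i\<in>I. {x. 0 \<le> f i \<bullet> x})" by (auto simp: dual_cone_def)
  then have "closed (dual_cone f I)" by (auto intro!: closed_INT closed_halfspace_ge)
  then have "compact (dual_cone f I \<inter> sphere 0 1)" by (intro closed_Int_compact) auto
  moreover have "continuous_on (dual_cone f I \<inter> sphere 0 1) (\<lambda>x. v \<bullet> x)" by (intro continuous_intros)
  ultimately obtain m where m: "m \<in> dual_cone f I \<inter> sphere 0 1"
    "\<And>x. x \<in> dual_cone f I \<inter> sphere 0 1 \<Longrightarrow> v \<bullet> m \<le> v \<bullet> x"
    using continuous_attains_inf[OF _ False, of "\<lambda>x. v \<bullet> x"] by blast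
  show ?thesis
  proof (rule that[of "v \<bullet> m"])
    show "0 < v \<bullet> m" using m(1) by (intro pos) auto
    fix x assume x: "x \<in> dual_cone f I"
    show "v \<bullet> m * norm x \<le> v \<bullet> x"
    proof (cases "x = 0")
      case False
      then have "v \<bullet> m \<le> v \<bullet> (x /\<^sub>R norm x)" using x by (intro m(2)) (simp add: dual_cone_scale)
      then show ?thesis using False by (simp add: field_simps)
    qed simp
  qed
qed

text \<open>The pair \<open>a\<close>, \<open>b\<close> confines the cone to a hyperplane. There
  positivity of \<open>\<phi>\<close> and \<open>\<psi>\<close> is reduced to nonnegativity of two
  perturbed functionals, each a conic combination of at most three constraints.\<close>

lemma opposite_pair_pointed:
  fixes f :: "'i \<Rightarrow> 'a::euclidean_space"
  assumes fin: "finite I" and DIM: "DIM('a) = 4"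
    and ab: "a \<in> I" "b \<in> I" "0 < c" "f a + c *\<^sub>R f b = 0" "f a \<noteq> 0"
    and r: "r \<noteq> 0" "f a \<bullet> r = 0" "\<phi> \<bullet> r = 0" "\<psi> \<bullet> r = 0"
      "\<And>x. f a \<bullet> x = 0 \<Longrightarrow> \<phi> \<bullet> x = 0 \<Longrightarrow> \<psi> \<bullet> x = 0 \<Longrightarrow> \<exists>s. x = s *\<^sub>R r"
    and pos: "\<And>x. x \<in> dual_cone f I \<Longrightarrow> x \<noteq> 0 \<Longrightarrow> 0 < \<phi> \<bullet> x \<and> 0 < \<psi> \<bullet> x"
  shows "\<exists>S\<subseteq>I. card S \<le> 6 \<and> (\<forall>x\<in>dual_cone f ({a, b} \<union> S). x \<noteq> 0 \<longrightarrow> 0 < \<phi> \<bullet> x \<and> 0 < \<psi> \<bullet> x)"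
proof -
  obtain e1 where e1: "0 < e1" "\<And>x. x \<in> dual_cone f I \<Longrightarrow> e1 * norm x \<le> \<phi> \<bullet> x"
    using dual_cone_positive_functional_bound[of f I \<phi>] pos by blast
  obtain e2 where e2: "0 < e2" "\<And>x. x \<in> dual_cone f I \<Longrightarrow> e2 * norm x \<le> \<psi> \<bullet> x"
    using dual_cone_positive_functional_bound[of f I \<psi>] pos by blast
  define M where "M = norm \<phi> + norm \<psi> + 1"
  have M: "M > 0" unfolding M_def by (simp add: add_nonneg_pos)
  \<comment> \<open>Small enough for the lower bounds \<open>e1\<close> and \<open>e2\<close> to
    absorb the perturbations; \<open>e < 1\<close> is used to recover the signs of
    \<open>\<phi>\<close> and \<open>\<psi>\<close>.\<close>
  define e where "e = min (1/2) (min (e1 / M) (e2 / M))"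
  have e: "0 < e" "e < 1" using e1(1) e2(1) M by (auto simp: e_def)
  have eM: "e * M \<le> e1" "e * M \<le> e2"
  proof -
    have "e \<le> e1 / M" "e \<le> e2 / M" by (auto simp: e_def)
    then show "e * M \<le> e1" "e * M \<le> e2" using M by (metis pos_le_divide_eq)+
  qed
  have bound: "0 \<le> (\<phi> - e *\<^sub>R \<psi>) \<bullet> x" "0 \<le> (\<psi> - e *\<^sub>R \<phi>) \<bullet> x" if x: "x \<in> dual_cone f I" for x
  proof -
    have "\<psi> \<bullet> x \<le> norm \<psi> * norm x" "\<phi> \<bullet> x \<le> norm \<phi> * norm x"
      by (rule norm_cauchy_schwarz)+
    moreover have "norm \<psi> * norm x \<le> M * norm x" "norm \<phi> * norm x \<le> M * norm x"
      by (auto simp: M_def intro!: mult_right_mono)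
    ultimately have "\<psi> \<bullet> x \<le> M * norm x" "\<phi> \<bullet> x \<le> M * norm x" by linarith+
    then have "e * (\<psi> \<bullet> x) \<le> (e * M) * norm x" "e * (\<phi> \<bullet> x) \<le> (e * M) * norm x"
      using e(1) by (simp_all add: mult.assoc)
    moreover have "(e * M) * norm x \<le> e1 * norm x" "(e * M) * norm x \<le> e2 * norm x"
      using eM by (auto intro!: mult_right_mono)
    ultimately show "0 \<le> (\<phi> - e *\<^sub>R \<psi>) \<bullet> x" "0 \<le> (\<psi> - e *\<^sub>R \<phi>) \<bullet> x"
      using e1(2)[OF x] e2(2)[OF x] by (simp_all add: inner_diff_left)
  qed
  \<comment> \<open>Orthogonal projection onto the hyperplane; independence in dimension three gives
    at most three constraints instead of four.\<close>
  define \<pi> where "\<pi> = (\<lambda>y. y - ((f a \<bullet> y) / (f a \<bullet> f a)) *\<^sub>R f a)"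
  have lin: "linear \<pi>"
    by (rule linearI) (simp_all add: \<pi>_def inner_add_right add_divide_distrib algebra_simps)
  have \<pi>a: "f a \<bullet> \<pi> y = 0" for y using ab(5) by (simp add: \<pi>_def inner_diff_right)
  have \<pi>x: "\<pi> y \<bullet> x = y \<bullet> x" if "f a \<bullet> x = 0" for x y using that by (simp add: \<pi>_def inner_diff_left)
  have rep: "\<exists>K k. K \<subseteq> I \<and> indep_family (\<lambda>i. \<pi> (f i)) K \<and> (\<forall>i\<in>K. 0 < k i) \<and>
      (\<forall>x. f a \<bullet> x = 0 \<longrightarrow> v \<bullet> x = (\<Sum>i\<in>K. k i * (f i \<bullet> x)))"
    if v: "\<And>x. x \<in> dual_cone f I \<Longrightarrow> 0 \<le> v \<bullet> x" for v
  proof -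
    obtain k0 where k0: "\<forall>i\<in>I. 0 \<le> k0 i" "v = (\<Sum>i\<in>I. k0 i *\<^sub>R f i)"
      using farkas_finite[OF fin v] by blast
    have "\<pi> v = (\<Sum>i\<in>I. k0 i *\<^sub>R \<pi> (f i))"
      unfolding k0(2) by (simp add: linear_sum[OF lin] linear_scale[OF lin])
    then obtain K k where K: "K \<subseteq> I" "indep_family (\<lambda>i. \<pi> (f i)) K" "\<And>i. i \<in> K \<Longrightarrow> 0 < k i"
      "\<pi> v = (\<Sum>i\<in>K. k i *\<^sub>R \<pi> (f i))"
      using conic_caratheodory[OF fin, of k0 "\<pi> v" "\<lambda>i. \<pi> (f i)"] k0 by blast
    have "v \<bullet> x = (\<Sum>i\<in>K. k i * (f i \<bullet> x))" if x: "f a \<bullet> x = 0" for x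
    proof -
      have "v \<bullet> x = (\<Sum>i\<in>K. k i *\<^sub>R \<pi> (f i)) \<bullet> x" using \<pi>x[OF x, of v] K(4) by simp
      then show ?thesis by (simp add: inner_sum_left \<pi>x[OF x])
    qed
    then show ?thesis using K by blast
  qed
  text \<open>On the hyperplane orthogonal to \<open>f a\<close>, nonnegativity of both functionals \<open>\<phi> - e *\<^sub>R \<psi>\<close> and
    \<open>\<psi> - e *\<^sub>R \<phi>\<close> forces \<open>\<phi>\<close> and \<open>\<psi>\<close> to be positive away from the line spanned by \<open>r\<close>.  If this
    line is not cut off by \<open>K\<close> and \<open>L\<close>, these are small enough to leave room for two
    more constraints.\<close>
  obtain K k where K: "K \<subseteq> I" "indep_family (\<lambda>i. \<pi> (f i)) K" "\<forall>i\<in>K. 0 < k i"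
    "\<forall>x. f a \<bullet> x = 0 \<longrightarrow> (\<phi> - e *\<^sub>R \<psi>) \<bullet> x = (\<Sum>i\<in>K. k i * (f i \<bullet> x))"
    using rep[OF bound(1)] by blast
  obtain L l where L: "L \<subseteq> I" "indep_family (\<lambda>i. \<pi> (f i)) L" "\<forall>i\<in>L. 0 < l i"
    "\<forall>x. f a \<bullet> x = 0 \<longrightarrow> (\<psi> - e *\<^sub>R \<phi>) \<bullet> x = (\<Sum>i\<in>L. l i * (f i \<bullet> x))"
    using rep[OF bound(2)] by blast
  have finKL: "finite K" "finite L" using K(1) L(1) fin finite_subset by blast+
  have pair: "f a \<bullet> x = 0" if "x \<in> dual_cone f S" "a \<in> S" "b \<in> S" for x S
    using dual_cone_circuit(1)[of "{b}" 1 "\<lambda>_. c" f a x] ab(3,4) that by (auto simp: dual_cone_def)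
  have sums: "0 \<le> (\<Sum>i\<in>K. k i * (f i \<bullet> x))" "0 \<le> (\<Sum>i\<in>L. l i * (f i \<bullet> x))"
    if "x \<in> dual_cone f S" "K \<union> L \<subseteq> S" for x S
    using that K(3) L(3) by (auto simp: dual_cone_def less_imp_le subset_iff intro!: sum_nonneg)
  \<comment> \<open>What remains to be supplied is \<open>r0\<close>, which excludes nonzero
    multiples of \<open>r\<close> on which all of \<open>K\<close> and \<open>L\<close>
    vanish.\<close>
  have main: "0 < \<phi> \<bullet> x \<and> 0 < \<psi> \<bullet> x"
    if x: "x \<in> dual_cone f S" "x \<noteq> 0" and S: "{a, b} \<union> K \<union> L \<subseteq> S"
      and r0: "\<And>s. s *\<^sub>R r \<in> dual_cone f S \<Longrightarrow> (\<And>i. i \<in> K \<union> L \<Longrightarrow> s * (f i \<bullet> r) = 0) \<Longrightarrow> s = 0" for x S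
  proof -
    have ax: "f a \<bullet> x = 0" using pair[OF x(1)] S by auto
    have KL: "K \<union> L \<subseteq> S" using S by auto
    have s: "e * (\<psi> \<bullet> x) \<le> \<phi> \<bullet> x" "e * (\<phi> \<bullet> x) \<le> \<psi> \<bullet> x"
      using sums[OF x(1) KL] K(4)[rule_format, OF ax] L(4)[rule_format, OF ax] by (simp_all add: inner_diff_left)
    \<comment> \<open>Inserting one estimate into the other leaves the positive factor
      \<open>1 - e * e\<close>.\<close>
    have "e * (e * (\<phi> \<bullet> x)) \<le> e * (\<psi> \<bullet> x)" "e * (e * (\<psi> \<bullet> x)) \<le> e * (\<phi> \<bullet> x)"
      using s e(1) by (simp_all only: mult_le_cancel_left_pos)
    then have "0 \<le> (1 - e * e) * (\<phi> \<bullet> x)" "0 \<le> (1 - e * e) * (\<psi> \<bullet> x)"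
      using s by (simp_all add: algebra_simps)
    moreover have "e * e < 1" using mult_strict_mono[OF e(2,2)] e(1) by simp
    ultimately have nn: "0 \<le> \<phi> \<bullet> x" "0 \<le> \<psi> \<bullet> x" by (simp_all add: zero_le_mult_iff)
    have "\<not> (\<phi> \<bullet> x = 0 \<and> \<psi> \<bullet> x = 0)"
    proof
      assume z: "\<phi> \<bullet> x = 0 \<and> \<psi> \<bullet> x = 0"
      then obtain s where xs: "x = s *\<^sub>R r" using r(5)[OF ax] by blast
      have "(\<Sum>i\<in>K. k i * (f i \<bullet> x)) = 0" "(\<Sum>i\<in>L. l i * (f i \<bullet> x)) = 0"
        using z K(4)[rule_format, OF ax] L(4)[rule_format, OF ax] by (simp_all add: inner_diff_left)
      moreover have "\<forall>i\<in>K. 0 \<le> k i * (f i \<bullet> x)" "\<forall>i\<in>L. 0 \<le> l i * (f i \<bullet> x)"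
        using x(1) S K(3) L(3) by (auto simp: dual_cone_def less_imp_le)
      ultimately have "\<forall>i\<in>K. k i * (f i \<bullet> x) = 0" "\<forall>i\<in>L. l i * (f i \<bullet> x) = 0"
        using finKL sum_nonneg_eq_0_iff[of K "\<lambda>i. k i * (f i \<bullet> x)"]
          sum_nonneg_eq_0_iff[of L "\<lambda>i. l i * (f i \<bullet> x)"] by simp_all
      then have "\<And>i. i \<in> K \<union> L \<Longrightarrow> f i \<bullet> x = 0" using K(3) L(3) by fastforce
      then have "s = 0" using x(1) by - (rule r0; auto simp: xs)
      then show False using x(2) xs by simp
    qed
    moreover have "\<phi> \<bullet> x = 0 \<longleftrightarrow> \<psi> \<bullet> x = 0" using s nn e(1) by (auto simp: mult_le_0_iff)
    ultimately show ?thesis using nn by auto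
  qed
  show ?thesis
  proof (cases "\<exists>i\<in>K \<union> L. f i \<bullet> r \<noteq> 0")
    case True
    have "dim {y. f a \<bullet> y = 0} = 3" using dim_hyperplane[OF ab(5)] DIM by simp
    then have "card K \<le> 3" "card L \<le> 3"
      using card_indep_family_le_dim[OF finKL(1) K(2), of "{y. f a \<bullet> y = 0}"]
        card_indep_family_le_dim[OF finKL(2) L(2), of "{y. f a \<bullet> y = 0}"] \<pi>a by auto
    then have "card (K \<union> L) \<le> 6" using card_Un_le[of K L] by linarith
    moreover have "\<forall>x\<in>dual_cone f ({a, b} \<union> (K \<union> L)). x \<noteq> 0 \<longrightarrow> 0 < \<phi> \<bullet> x \<and> 0 < \<psi> \<bullet> x"
    proof (intro ballI impI)
      fix x assume x: "x \<in> dual_cone f ({a, b} \<union> (K \<union> L))" "x \<noteq> 0"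
      show "0 < \<phi> \<bullet> x \<and> 0 < \<psi> \<bullet> x"
        by (rule main[OF x]) (use True in auto)
    qed
    ultimately show ?thesis using K(1) L(1) by (intro exI[of _ "K \<union> L"]) auto
  next
    case False
    \<comment> \<open>After projection \<open>K\<close> and \<open>L\<close> lie in the
      two-dimensional complement of \<open>f a\<close> and \<open>r\<close>, so each has at most two
      elements.\<close>
    have ar: "f a \<noteq> r" using r(1,2) by auto
    have "pairwise orthogonal {f a, r}" using r(2) by (auto simp: pairwise_def orthogonal_def inner_commute)
    then have ind: "independent {f a, r}" using ab(5) r(1) by (intro pairwise_orthogonal_independent) auto
    let ?P = "{y \<in> UNIV. \<forall>x\<in>span {f a, r}. orthogonal x y}"
    have "dim ?P + dim (span {f a, r}) = dim (UNIV :: 'a set)"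
      by (rule dim_subspace_orthogonal_to_vectors) auto
    then have dP: "dim ?P = 2" using ind DIM ar by (simp add: dim_eq_card_independent)
    have inP: "\<pi> (f i) \<in> ?P" if "i \<in> K \<union> L" for i
    proof -
      have "orthogonal (\<pi> (f i)) y" if y: "y \<in> {f a, r}" for y
        using y False \<open>i \<in> K \<union> L\<close> \<pi>a[of "f i"] \<pi>x[OF r(2), of "f i"]
        by (auto simp: orthogonal_def inner_commute)
      then show ?thesis using orthogonal_to_span[of _ "{f a, r}" "\<pi> (f i)"]
        by (auto simp: orthogonal_commute)
    qed
    have "card K \<le> 2" "card L \<le> 2"
      using card_indep_family_le_dim[OF finKL(1) K(2), of ?P]
        card_indep_family_le_dim[OF finKL(2) L(2), of ?P] inP dP by auto
    moreover have "r \<notin> dual_cone f I" "- r \<notin> dual_cone f I" using pos[of r] pos[of "- r"] r by auto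
    then obtain i j where ij: "i \<in> I" "j \<in> I" "\<And>s. s *\<^sub>R r \<in> dual_cone f {i, j} \<Longrightarrow> s = 0"
      by (rule dual_cone_separating_pair) blast
    have "card {i, j} \<le> 2" by (simp add: card_insert_if)
    ultimately have "card (K \<union> L \<union> {i, j}) \<le> 6"
      using card_Un_le[of K L] card_Un_le[of "K \<union> L" "{i, j}"] by linarith
    moreover have "\<forall>x\<in>dual_cone f ({a, b} \<union> (K \<union> L \<union> {i, j})). x \<noteq> 0 \<longrightarrow> 0 < \<phi> \<bullet> x \<and> 0 < \<psi> \<bullet> x"
    proof (intro ballI impI)
      fix x assume x: "x \<in> dual_cone f ({a, b} \<union> (K \<union> L \<union> {i, j}))" "x \<noteq> 0"
      show "0 < \<phi> \<bullet> x \<and> 0 < \<psi> \<bullet> x"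
      proof (rule main[OF x])
        fix s assume "s *\<^sub>R r \<in> dual_cone f ({a, b} \<union> (K \<union> L \<union> {i, j}))"
        then show "s = 0" using ij(3) dual_cone_antimono[of "{i, j}" "{a, b} \<union> (K \<union> L \<union> {i, j})" f] by blast
      qed auto
    qed
    ultimately show ?thesis using K(1) L(1) ij(1,2) by (intro exI[of _ "K \<union> L \<union> {i, j}"]) auto
  qed
qed

text \<open>On the hyperplane orthogonal to the pair, minus \<open>\<sigma> * klein_form\<close> is
  the product of \<open>\<phi>\<close> and \<open>\<psi>\<close>. If \<open>\<phi>\<close> takes
  both signs on the cone, the cone is a line and Steinitz in dimension three leaves six constraints;
  otherwise both factors have one common sign and the pointed case applies.\<close>

lemma opposite_pair_reduction:
  fixes f :: "'i \<Rightarrow> quad"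
  assumes fin: "finite I" and ab: "a \<in> I" "b \<in> I" "0 < c" "f a + c *\<^sub>R f b = 0"
    and rank: "fst (f a) \<noteq> 0" "snd (f a) = \<mu> *\<^sub>R fst (f a)"
    and neg: "\<And>x. x \<in> dual_cone f I \<Longrightarrow> x \<noteq> 0 \<Longrightarrow> \<sigma> * klein_form x < 0" and \<sigma>: "\<bar>\<sigma>\<bar> = 1"
  shows "\<exists>S\<subseteq>I. card S \<le> 6 \<and> (\<forall>x\<in>dual_cone f ({a, b} \<union> S). x \<noteq> 0 \<longrightarrow> \<sigma> * klein_form x < 0)"
proof -
  obtain \<phi>0 \<psi> r where r: "r \<noteq> 0" "f a \<bullet> r = 0" "\<phi>0 \<bullet> r = 0" "\<psi> \<bullet> r = 0"
    "\<And>x. f a \<bullet> x = 0 \<Longrightarrow> klein_form x = - ((\<phi>0 \<bullet> x) * (\<psi> \<bullet> x))"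
    "\<And>x. f a \<bullet> x = 0 \<Longrightarrow> \<phi>0 \<bullet> x = 0 \<Longrightarrow> \<psi> \<bullet> x = 0 \<Longrightarrow> \<exists>s. x = s *\<^sub>R r"
    by (rule null_hyperplane_factorization[OF rank]) blast
  define \<phi> where "\<phi> = \<sigma> *\<^sub>R \<phi>0"
  have \<sigma>0: "\<sigma> \<noteq> 0" using \<sigma> by auto
  have fac: "\<sigma> * klein_form x = - ((\<phi> \<bullet> x) * (\<psi> \<bullet> x))" if "f a \<bullet> x = 0" for x
    using r(5)[OF that] by (simp add: \<phi>_def)
  have fa: "f a \<noteq> 0" using rank(1) by auto
  have pair: "f a \<bullet> x = 0" if "x \<in> dual_cone f S" "a \<in> S" "b \<in> S" for x S
    using dual_cone_circuit(1)[of "{b}" 1 "\<lambda>_. c" f a x] ab(3,4) that by (auto simp: dual_cone_def)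
  have prod: "0 < (\<phi> \<bullet> x) * (\<psi> \<bullet> x)" if "x \<in> dual_cone f I" "x \<noteq> 0" for x
    using neg[OF that] fac[OF pair[OF that(1) ab(1,2)]] by simp
  show ?thesis
  proof (cases "\<exists>t\<in>dual_cone f I. \<exists>t'\<in>dual_cone f I. 0 < \<phi> \<bullet> t \<and> \<phi> \<bullet> t' < 0")
    case True
    then obtain t t' where t: "t \<in> dual_cone f I" "t' \<in> dual_cone f I" "0 < \<phi> \<bullet> t" "\<phi> \<bullet> t' < 0" by blast
    have opp: "- x \<in> dual_cone f I"
      if x: "x \<in> dual_cone f I" "y \<in> dual_cone f I" "(\<phi> \<bullet> x) * (\<phi> \<bullet> y) < 0" for x y
    proof -
      \<comment> \<open>The positive combination on which \<open>\<phi>\<close> vanishes; the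
        product with \<open>\<psi>\<close> is positive at nonzero points of the cone, so
        \<open>z\<close> is zero and \<open>y\<close> is a negative multiple of
        \<open>x\<close>.\<close>
      define z where "z = \<bar>\<phi> \<bullet> y\<bar> *\<^sub>R x + \<bar>\<phi> \<bullet> x\<bar> *\<^sub>R y"
      have "z \<in> dual_cone f I" using x by (simp add: z_def dual_cone_add dual_cone_scale)
      moreover have "\<phi> \<bullet> z = 0"
        using x(3) by (auto simp: z_def inner_add_right mult_less_0_iff)
      ultimately have "z = 0" using prod[of z] by auto
      have y0: "\<bar>\<phi> \<bullet> y\<bar> > 0" using x(3) by auto
      have "\<bar>\<phi> \<bullet> x\<bar> *\<^sub>R y + \<bar>\<phi> \<bullet> y\<bar> *\<^sub>R x = 0"
        using \<open>z = 0\<close> by (simp add: z_def add.commute)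
      then have "\<bar>\<phi> \<bullet> x\<bar> *\<^sub>R y = - (\<bar>\<phi> \<bullet> y\<bar> *\<^sub>R x)" by (simp only: eq_neg_iff_add_eq_0)
      moreover have "(1 / \<bar>\<phi> \<bullet> y\<bar>) *\<^sub>R (\<bar>\<phi> \<bullet> x\<bar> *\<^sub>R y) \<in> dual_cone f I"
        using x(2) by (intro dual_cone_scale) auto
      ultimately show ?thesis using y0 by simp
    qed
    have sym: "- x \<in> dual_cone f I" if x: "x \<in> dual_cone f I" for x
    proof (cases "x = 0")
      case False
      then have "\<phi> \<bullet> x \<noteq> 0" using prod[OF x] by auto
      then consider "0 < \<phi> \<bullet> x" | "\<phi> \<bullet> x < 0" by linarith
      then show ?thesis
        by cases (use opp[OF x t(2)] opp[OF x t(1)] t(3,4) in \<open>auto simp: mult_less_0_iff\<close>)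
    qed (use x in simp)
    obtain S where S: "S \<subseteq> I" "dual_cone f S = dual_cone f I" "card S \<le> 2 * dim (f ` I)"
      by (rule steinitz_symmetric[OF fin sym])
    have "t \<bullet> f i = 0" if "i \<in> I" for i
      using dual_coneD[OF t(1) that] dual_coneD[OF sym[OF t(1)] that] by (simp add: inner_commute)
    then have "f ` I \<subseteq> {x. t \<bullet> x = 0}" by auto
    moreover have "t \<noteq> 0" using t(3) by auto
    ultimately have "dim (f ` I) \<le> 3"
      using dim_subset[of "f ` I" "{x. t \<bullet> x = 0}"] dim_hyperplane[of t] by simp
    then have "card S \<le> 6" using S(3) by linarith
    moreover have "dual_cone f ({a, b} \<union> S) \<subseteq> dual_cone f I"
      using dual_cone_antimono[of S "{a, b} \<union> S" f] S(2) by auto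
    ultimately show ?thesis using S(1) neg by blast
  next
    case False
    then have "\<exists>s. \<bar>s\<bar> = (1::real) \<and> (\<forall>x\<in>dual_cone f I. 0 \<le> s * (\<phi> \<bullet> x))"
    proof (cases "\<exists>t\<in>dual_cone f I. 0 < \<phi> \<bullet> t")
      case True
      then show ?thesis using False by (intro exI[of _ 1]) force
    next
      case False
      then show ?thesis by (intro exI[of _ "-1"]) force
    qed
    then obtain s where s: "\<bar>s\<bar> = (1::real)" "\<forall>x\<in>dual_cone f I. 0 \<le> s * (\<phi> \<bullet> x)" by blast
    have ss: "s * s = 1" using s(1) by (auto simp: abs_if split: if_splits)
    have s0: "s \<noteq> 0" using s(1) by auto
    have "\<exists>S\<subseteq>I. card S \<le> 6 \<and>
      (\<forall>x\<in>dual_cone f ({a, b} \<union> S). x \<noteq> 0 \<longrightarrow> 0 < (s *\<^sub>R \<phi>) \<bullet> x \<and> 0 < (s *\<^sub>R \<psi>) \<bullet> x)"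
    proof (rule opposite_pair_pointed[OF fin _ ab fa r(1,2)])
      show "\<exists>u. x = u *\<^sub>R r" if "f a \<bullet> x = 0" "(s *\<^sub>R \<phi>) \<bullet> x = 0" "(s *\<^sub>R \<psi>) \<bullet> x = 0" for x
        using r(6)[OF that(1)] that s0 \<sigma>0 by (simp add: \<phi>_def)
      show "0 < (s *\<^sub>R \<phi>) \<bullet> x \<and> 0 < (s *\<^sub>R \<psi>) \<bullet> x" if x: "x \<in> dual_cone f I" "x \<noteq> 0" for x
      proof -
        have "0 < (s * s) * ((\<phi> \<bullet> x) * (\<psi> \<bullet> x))" using prod[OF x] ss by simp
        then have "0 < (s * (\<phi> \<bullet> x)) * (s * (\<psi> \<bullet> x))" by (simp add: mult.assoc mult.left_commute)
        moreover have "0 \<le> s * (\<phi> \<bullet> x)" using s(2) x by blast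
        ultimately show ?thesis by (auto simp: zero_less_mult_iff)
      qed
    qed (use r in \<open>simp_all add: \<phi>_def\<close>)
    then obtain S where S: "S \<subseteq> I" "card S \<le> 6"
      "\<And>x. x \<in> dual_cone f ({a, b} \<union> S) \<Longrightarrow> x \<noteq> 0 \<Longrightarrow> 0 < s * (\<phi> \<bullet> x) \<and> 0 < s * (\<psi> \<bullet> x)" by auto
    have "\<sigma> * klein_form x < 0" if x: "x \<in> dual_cone f ({a, b} \<union> S)" "x \<noteq> 0" for x
    proof -
      have "0 < (s * (\<phi> \<bullet> x)) * (s * (\<psi> \<bullet> x))" using S(3)[OF x] by simp
      then have "0 < (s * s) * ((\<phi> \<bullet> x) * (\<psi> \<bullet> x))" by (simp add: mult.assoc mult.left_commute)
      then have "0 < (\<phi> \<bullet> x) * (\<psi> \<bullet> x)" using ss by simp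
      then show ?thesis using fac[of x] pair[OF x(1)] by simp
    qed
    then show ?thesis using S by blast
  qed
qed

text \<open>Farkas in five dimensions gives a certificate: the vector with components 0 and
  \<open>\<sigma>\<close> is a positive combination of an independent family \<open>h\<close> on
  \<open>J\<close>. It secures the first half of one-sidedness for every set containing
  \<open>J\<close>. The covectors of \<open>J\<close> form a positive circuit, whose size decides
  what must be added for the second half.\<close>

lemma one_sided_reduction:
  fixes f :: "'i \<Rightarrow> quad"
  assumes fin: "finite I"
    and rank: "\<And>i. i \<in> I \<Longrightarrow> fst (f i) \<noteq> 0 \<and> (\<exists>\<mu>. snd (f i) = \<mu> *\<^sub>R fst (f i))"
    and os: "one_sided f \<delta> klein_form \<sigma> I" and \<sigma>: "\<bar>\<sigma>\<bar> = 1" and nt: "dual_cone f I \<noteq> {0}"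
  shows "\<exists>J\<subseteq>I. one_sided f \<delta> klein_form \<sigma> J \<and> card J \<le> 8 \<and>
    ((\<forall>i\<in>I. \<forall>j\<in>I. i \<noteq> j \<longrightarrow> (\<forall>c. f i \<noteq> c *\<^sub>R f j)) \<longrightarrow> card J \<le> 6)"
proof -
  have null: "klein_form (f i) = 0" if "i \<in> I" for i
    using rank[OF that] by (auto simp: klein_form_def)
  have nz: "f i \<noteq> 0" if "i \<in> I" for i using rank[OF that] by auto
  have neg: "\<sigma> * klein_form x < 0" if "x \<in> dual_cone f I" "x \<noteq> 0" for x
    using os that by (auto simp: one_sided_def)
  obtain t0 where t0: "t0 \<in> dual_cone f I" "t0 \<noteq> 0" using nt zero_in_dual_cone[of f I] by blast
  define h where "h = (\<lambda>i. (f i, \<delta> i))"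
  have "0 \<le> ((0::quad), \<sigma>) \<bullet> y" if "y \<in> dual_cone h I" for y
    using that os by (cases y) (auto simp: h_def dual_cone_def one_sided_def inner_prod_def)
  then obtain c where "\<forall>i\<in>I. 0 \<le> c i" "((0::quad), \<sigma>) = (\<Sum>i\<in>I. c i *\<^sub>R h i)"
    using farkas_finite[OF fin, of h "(0, \<sigma>)"] by blast
  then obtain J d where J: "J \<subseteq> I" "indep_family h J" "\<And>j. j \<in> J \<Longrightarrow> 0 < d j"
    "((0::quad), \<sigma>) = (\<Sum>j\<in>J. d j *\<^sub>R h j)"
    using conic_caratheodory[OF fin, of c "(0, \<sigma>)" h] by blast
  have finJ: "finite J" using J(1) fin finite_subset by blast
  have rel: "(\<Sum>j\<in>J. d j *\<^sub>R f j) = 0" "(\<Sum>j\<in>J. d j * \<delta> j) = \<sigma>"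
    using arg_cong[OF J(4), of fst] arg_cong[OF J(4), of snd] by (simp_all add: h_def fst_sum snd_sum)
  have \<sigma>0: "\<sigma> \<noteq> 0" using \<sigma> by auto
  have side: "0 \<le> \<sigma> * z" if "J \<subseteq> S" "\<forall>i\<in>S. 0 \<le> f i \<bullet> x + \<delta> i * z" for S x z
  proof -
    have "0 \<le> (\<Sum>j\<in>J. d j * (f j \<bullet> x + \<delta> j * z))"
      using that J(3) by (intro sum_nonneg mult_nonneg_nonneg) (auto simp: less_imp_le)
    also have "\<dots> = (\<Sum>j\<in>J. d j *\<^sub>R f j) \<bullet> x + (\<Sum>j\<in>J. d j * \<delta> j) * z"
      by (simp add: inner_sum_left sum_distrib_right distrib_left sum.distrib mult.assoc)
    finally show ?thesis by (simp add: rel)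
  qed
  have "J \<noteq> {}" using rel(2) \<sigma>0 by (metis sum.empty)
  then obtain a where a: "a \<in> J" by blast
  define B where "B = J - {a}"
  have JB: "J = insert a B" "a \<notin> B" "finite B" using a finJ by (auto simp: B_def)
  have relB: "d a *\<^sub>R f a + (\<Sum>b\<in>B. d b *\<^sub>R f b) = 0" using rel(1) JB by simp
  have BI: "B \<subseteq> I" "a \<in> I" using J(1) JB by auto
  \<comment> \<open>A relation among the \<open>f b\<close> lifts to \<open>h\<close> after
    subtracting \<open>s\<close> times the certificate, which corrects the last coordinate; the
    coefficient at \<open>a\<close> then forces \<open>s = 0\<close>.\<close>
  have indB: "indep_family f B"
    unfolding indep_family_def
  proof (intro allI impI)
    fix e assume e: "(\<Sum>b\<in>B. e b *\<^sub>R f b) = 0"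
    define s where "s = (\<Sum>b\<in>B. e b * \<delta> b) / \<sigma>"
    define e' where "e' = (\<lambda>j. (if j = a then 0 else e j) - s * d j)"
    have split: "(\<Sum>j\<in>J. e' j *\<^sub>R h j) = (\<Sum>j\<in>J. (if j = a then 0 else e j) *\<^sub>R h j) - s *\<^sub>R (\<Sum>j\<in>J. d j *\<^sub>R h j)"
      by (simp add: e'_def scaleR_diff_left sum_subtractf scaleR_sum_right)
    have "(\<Sum>j\<in>J. (if j = a then 0 else e j) *\<^sub>R h j) = (\<Sum>j\<in>B. (if j = a then 0 else e j) *\<^sub>R h j)"
      using JB by simp
    also have "\<dots> = (\<Sum>j\<in>B. e j *\<^sub>R h j)" using JB(2) by (intro sum.cong) auto
    also have "\<dots> = (0, s * \<sigma>)"
      using e \<sigma>0 by (simp add: prod_eq_iff fst_sum snd_sum h_def s_def)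
    finally have "(\<Sum>j\<in>J. e' j *\<^sub>R h j) = 0"
      unfolding split by (simp flip: J(4) add: zero_prod_def)
    then have z: "\<forall>j\<in>J. e' j = 0" using J(2) by (simp add: indep_family_def)
    then have "e' a = 0" using a by blast
    then have "s * d a = 0" by (simp add: e'_def)
    then have "s = 0" using J(3)[OF a] by simp
    show "\<forall>b\<in>B. e b = 0"
    proof
      fix b assume b: "b \<in> B"
      then have "e' b = 0" "b \<noteq> a" using z JB by auto
      then show "e b = 0" using \<open>s = 0\<close> by (simp add: e'_def)
    qed
  qed
  have Bne: "B \<noteq> {}" using relB nz[OF BI(2)] J(3)[OF a] by auto
  have orth: "f b \<bullet> x = 0" if "x \<in> dual_cone f J" "b \<in> B" for b x
    using dual_cone_circuit(2)[OF JB(3), of "d a" d f a x b] J(3) JB(1) relB that by auto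
  have "card B \<le> DIM(quad)" by (rule card_indep_family_le_DIM[OF JB(3) indB])
  moreover have "0 < card B" using Bne JB(3) by (simp add: card_gt_0_iff)
  ultimately consider "card B = 1" | "card B = 2" | "card B = 3" | "card B = 4" by (simp; linarith)
  then show ?thesis
  proof cases
    case 1
    then obtain b where b: "B = {b}" by (meson card_1_singletonE)
    have pos: "0 < d a" "0 < d b" using J(3) JB(1) b by auto
    have ab: "f a + (d b / d a) *\<^sub>R f b = 0"
    proof -
      have "(1 / d a) *\<^sub>R (d a *\<^sub>R f a + d b *\<^sub>R f b) = 0" using relB b by simp
      then show ?thesis using pos by (simp add: scaleR_add_right)
    qed
    obtain \<mu> where \<mu>: "snd (f a) = \<mu> *\<^sub>R fst (f a)" using rank[OF BI(2)] by blast
    have bI: "b \<in> I" "a \<noteq> b" using BI JB(2) b by auto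
    have "0 < d b / d a" using pos by simp
    then obtain S where S: "S \<subseteq> I" "card S \<le> 6" "\<forall>x\<in>dual_cone f ({a, b} \<union> S). x \<noteq> 0 \<longrightarrow> \<sigma> * klein_form x < 0"
      using opposite_pair_reduction[OF fin BI(2) bI(1) _ ab _ \<mu> neg \<sigma>] rank[OF BI(2)] by blast
    have "card ({a, b} \<union> S) \<le> 8" using card_Un_le[of "{a, b}" S] S(2) bI(2) by simp
    moreover have "one_sided f \<delta> klein_form \<sigma> ({a, b} \<union> S)"
      unfolding one_sided_def using side[of "{a, b} \<union> S"] S(3) JB(1) b by blast
    \<comment> \<open>Opposite covectors are proportional, so the premise of the bound six fails and
      only eight is claimed.\<close>
    moreover have "f a = (- (d b / d a)) *\<^sub>R f b" using ab by (simp add: eq_neg_iff_add_eq_0)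
    ultimately show ?thesis using S(1) BI(2) bI by (intro exI[of _ "{a, b} \<union> S"]) blast
  next
    case 2
    then obtain b c where bc: "B = {b, c}" "b \<noteq> c" by (auto simp: card_2_iff)
    have I: "b \<in> I" "c \<in> I" using BI bc by auto
    have pos: "0 < d b" "0 < d c" using J(3) JB(1) bc by auto
    have "s = 0 \<and> t = 0" if "s *\<^sub>R f b + t *\<^sub>R f c = 0" for s t
    proof -
      from that have "(\<Sum>j\<in>B. (if j = b then s else t) *\<^sub>R f j) = 0" using bc by simp
      then have "\<forall>j\<in>B. (if j = b then s else t) = 0" using indB unfolding indep_family_def
        by (elim allE[of _ "\<lambda>j. if j = b then s else t"]) simp
      then show ?thesis using bc by (auto split: if_splits)
    qed
    \<comment> \<open>A circuit of three spans an isotropic plane, so the nonzero \<open>t0\<close>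
      orthogonal to it would be null, contrary to \<open>neg\<close>.\<close>
    moreover have "f b \<bullet> klein_polar (f c) = 0"
      using klein_isotropic_relation[of "f b" "f c" "f a" "d b" "d c" "d a"] null I BI(2) relB bc pos
      by (simp add: add.commute add.left_commute)
    moreover have "t0 \<in> dual_cone f J" using t0(1) dual_cone_antimono[OF J(1)] by blast
    then have "f b \<bullet> t0 = 0" "f c \<bullet> t0 = 0" using orth bc by auto
    ultimately have "klein_form t0 = 0"
      using isotropic_plane_complement_null[of "f b" "f c" t0] null I by blast
    then show ?thesis using neg[OF t0] by simp
  next
    case 3
    obtain t where t: "t \<noteq> 0" "\<And>b. b \<in> B \<Longrightarrow> f b \<bullet> t = 0"
      "\<And>x. (\<And>b. b \<in> B \<Longrightarrow> f b \<bullet> x = 0) \<Longrightarrow> \<exists>s. x = s *\<^sub>R t"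
      by (rule corank_one_orthogonal_line[OF JB(3) indB]) (use 3 in auto)
    have "t0 \<in> dual_cone f J" using t0(1) dual_cone_antimono[OF J(1)] by blast
    then obtain s0 where s0: "t0 = s0 *\<^sub>R t" using t(3) orth by blast
    have "s0 \<noteq> 0" using t0(2) s0 by auto
    \<comment> \<open>The cone of \<open>J\<close> lies on the line through \<open>t\<close>, where
      the form keeps the sign it has at \<open>t0\<close>.\<close>
    have "\<sigma> * klein_form x < 0" if x: "x \<in> dual_cone f J" "x \<noteq> 0" for x
    proof -
      obtain s where s: "x = s *\<^sub>R t" using t(3) orth[OF x(1)] by blast
      have "s0\<^sup>2 * (\<sigma> * klein_form t) < 0"
        using neg[OF t0] by (simp add: s0 klein_form_scaleR mult.left_commute)
      then have "\<sigma> * klein_form t < 0" by (simp add: mult_less_0_iff)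
      moreover have "0 < s\<^sup>2" using x(2) s by auto
      ultimately have "s\<^sup>2 * (\<sigma> * klein_form t) < 0" by (rule mult_pos_neg[rotated])
      then show ?thesis by (simp add: s klein_form_scaleR mult.left_commute)
    qed
    then have "one_sided f \<delta> klein_form \<sigma> J" unfolding one_sided_def using side[of J] by blast
    moreover have "card J \<le> 6" using 3 JB by simp
    ultimately show ?thesis using J(1) by (intro exI[of _ J]) auto
  next
    case 4
    have "x = 0" if x: "x \<in> dual_cone f J" for x
      by (rule indep_family_orthogonal_imp_zero[OF JB(3) indB]) (use 4 orth[OF x] in auto)
    then have "one_sided f \<delta> klein_form \<sigma> J" unfolding one_sided_def using side[of J] by blast
    moreover have "card J \<le> 6" using 4 JB by simp
    ultimately show ?thesis using J(1) by (intro exI[of _ J]) auto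
  qed
qed

text \<open>One dichotomy serves both bounds: a trivial cone is handled by Steinitz in dimension
  four or by the null vector argument, a nontrivial one by a certificate. The subfamily found
  isolates the origin by \<open>isolated_originI\<close>.\<close>

lemma isolated_origin_reduction:
  fixes f :: "'i \<Rightarrow> quad"
  assumes fin: "finite I"
    and rank: "\<And>i. i \<in> I \<Longrightarrow> fst (f i) \<noteq> 0 \<and> (\<exists>\<mu>. snd (f i) = \<mu> *\<^sub>R fst (f i))"
    and iso: "isolated_origin f \<delta> klein_form I"
  shows "\<exists>J\<subseteq>I. isolated_origin f \<delta> klein_form J \<and> card J \<le> 8"
    and "(\<forall>i\<in>I. \<forall>j\<in>I. i \<noteq> j \<longrightarrow> (\<forall>c. f i \<noteq> c *\<^sub>R f j)) \<Longrightarrow>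
      \<exists>J\<subseteq>I. isolated_origin f \<delta> klein_form J \<and> card J \<le> 6"
proof -
  have isoI: "isolated_origin f \<delta> klein_form J"
    if "dual_cone f J = {0} \<or> one_sided f \<delta> klein_form \<sigma> J" for J \<sigma>
    by (rule isolated_originI[OF continuous_on_klein_form klein_form_scaleR that])
  have null: "klein_form (f i) = 0" if "i \<in> I" for i
    using rank[OF that] by (auto simp: klein_form_def)
  have nz: "f i \<noteq> 0" if "i \<in> I" for i using rank[OF that] by auto
  show "\<exists>J\<subseteq>I. isolated_origin f \<delta> klein_form J \<and> card J \<le> 8"
  proof (cases "dual_cone f I = {0}")
    case True
    obtain J where J: "J \<subseteq> I" "dual_cone f J = dual_cone f I" "card J \<le> 2 * dim (f ` I)"
      by (rule steinitz_symmetric[OF fin, of f]) (use True in auto)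
    have "dim (f ` I) \<le> DIM(quad)" by (rule dim_subset_UNIV)
    then have "card J \<le> 8" using J(3) by simp
    moreover have "isolated_origin f \<delta> klein_form J" by (rule isoI) (use J(2) True in simp)
    ultimately show ?thesis using J(1) by blast
  next
    case False
    obtain \<sigma> where \<sigma>: "\<bar>\<sigma>\<bar> = 1" "one_sided f \<delta> klein_form \<sigma> I"
      by (rule isolated_origin_one_sided[OF iso continuous_on_klein_form klein_form_scaleR False])
    show ?thesis using one_sided_reduction[OF fin rank \<sigma>(2,1) False] isoI by blast
  qed
  assume nonpar: "\<forall>i\<in>I. \<forall>j\<in>I. i \<noteq> j \<longrightarrow> (\<forall>c. f i \<noteq> c *\<^sub>R f j)"
  show "\<exists>J\<subseteq>I. isolated_origin f \<delta> klein_form J \<and> card J \<le> 6"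
  proof (cases "dual_cone f I = {0}")
    case True
    have "\<exists>J\<subseteq>I. card J \<le> 6 \<and> dual_cone f J = {0}"
      by (rule positive_spanning_null_card_le_6[OF fin null nz _ True]) (use nonpar in auto)
    then show ?thesis using isoI by blast
  next
    case False
    obtain \<sigma> where \<sigma>: "\<bar>\<sigma>\<bar> = 1" "one_sided f \<delta> klein_form \<sigma> I"
      by (rule isolated_origin_one_sided[OF iso continuous_on_klein_form klein_form_scaleR False])
    show ?thesis using one_sided_reduction[OF fin rank \<sigma>(2,1) False] isoI nonpar by blast
  qed
qed

section \<open>Coordinates on lines near \<open>l0\<close> and the translation of pinning\<close>

section \<open>A chart of the space of lines\<close>

lemma cross3_Cramer:
  fixes a b c y :: "real^3"
  shows "(a \<bullet> cross3 b c) *\<^sub>R y =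
    (y \<bullet> cross3 b c) *\<^sub>R a + (a \<bullet> cross3 y c) *\<^sub>R b + (a \<bullet> cross3 b y) *\<^sub>R c"
  by (simp add: vec_eq_iff forall_3 cross3_def inner_vec_def sum_3; simp add: algebra_simps)

text \<open>Meeting means that the difference of base points, corrected by the translation, is a
  combination of the two directions, that is, orthogonal to their cross product; Cramer supplies the
  coefficients.\<close>

lemma meets_translate_cross_iff:
  assumes "cross3 (snd g) (snd l) \<noteq> 0"
  shows "meets (translate (t *\<^sub>R cross3 (snd g) (snd l)) l) g \<longleftrightarrow>
    (fst g - fst l) \<bullet> cross3 (snd g) (snd l) = t * (norm (cross3 (snd g) (snd l)))\<^sup>2"
proof -
  define N where "N = cross3 (snd g) (snd l)"
  have N: "snd g \<bullet> N = 0" "snd l \<bullet> N = 0" by (simp_all add: N_def dot_cross_self)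
  have NN: "N \<bullet> N \<noteq> 0" using assms by (simp add: N_def)
  show ?thesis unfolding N_def[symmetric] power2_norm_eq_inner
  proof
    assume "meets (translate (t *\<^sub>R N) l) g"
    then obtain s r where "fst l + t *\<^sub>R N + s *\<^sub>R snd l = fst g + r *\<^sub>R snd g"
      by (auto simp: meets_def on_line_def translate_def)
    then have eq: "fst g - fst l = t *\<^sub>R N + s *\<^sub>R snd l - r *\<^sub>R snd g" by (simp add: algebra_simps)
    show "(fst g - fst l) \<bullet> N = t * (N \<bullet> N)"
      unfolding eq by (simp add: inner_add_left inner_diff_left N)
  next
    assume *: "(fst g - fst l) \<bullet> N = t * (N \<bullet> N)"
    define y where "y = fst g - fst l - t *\<^sub>R N"
    have yN: "y \<bullet> N = 0" using * by (simp add: y_def inner_diff_left)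
    have perm: "snd g \<bullet> cross3 (snd l) z = z \<bullet> N" for z
      by (simp add: N_def cross3_simps)
    define A where "A = (y \<bullet> cross3 (snd l) N) / (N \<bullet> N)"
    define B where "B = (snd g \<bullet> cross3 y N) / (N \<bullet> N)"
    have "(N \<bullet> N) *\<^sub>R y = (y \<bullet> cross3 (snd l) N) *\<^sub>R snd g + (snd g \<bullet> cross3 y N) *\<^sub>R snd l"
      using cross3_Cramer[of "snd g" "snd l" N y] by (simp add: perm yN)
    then have "(1 / (N \<bullet> N)) *\<^sub>R ((N \<bullet> N) *\<^sub>R y) =
      (1 / (N \<bullet> N)) *\<^sub>R ((y \<bullet> cross3 (snd l) N) *\<^sub>R snd g + (snd g \<bullet> cross3 y N) *\<^sub>R snd l)" by simp
    then have "y = A *\<^sub>R snd g + B *\<^sub>R snd l" using NN by (simp add: A_def B_def scaleR_add_right)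
    then have "fst l + t *\<^sub>R N + B *\<^sub>R snd l = fst g + (- A) *\<^sub>R snd g"
      by (simp add: y_def algebra_simps)
    then have "on_line (fst l + t *\<^sub>R N + B *\<^sub>R snd l) g" unfolding on_line_def by blast
    moreover have "on_line (fst l + t *\<^sub>R N + B *\<^sub>R snd l) (translate (t *\<^sub>R N) l)"
      by (auto simp: on_line_def translate_def)
    ultimately show "meets (translate (t *\<^sub>R N) l) g" unfolding meets_def by blast
  qed
qed

text \<open>The only translation parameter producing a meeting is the triple product divided by a
  positive number; zero means meeting, positive means passing to the right.\<close>

lemma satisfies_iff_triple_product:
  assumes "cross3 (snd g) (snd l) \<noteq> 0"
  shows "satisfies l g \<longleftrightarrow> 0 \<le> (fst g - fst l) \<bullet> cross3 (snd g) (snd l)"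
proof -
  define N where "N = cross3 (snd g) (snd l)"
  have n2: "0 < (norm N)\<^sup>2" using assms by (simp add: N_def)
  have m: "meets (translate (t *\<^sub>R N) l) g \<longleftrightarrow> (fst g - fst l) \<bullet> N = t * (norm N)\<^sup>2" for t
    unfolding N_def by (rule meets_translate_cross_iff[OF assms])
  have m0: "meets l g \<longleftrightarrow> (fst g - fst l) \<bullet> N = 0"
    using m[of 0] by (simp add: translate_def)
  have "(\<exists>t>0. (fst g - fst l) \<bullet> N = t * (norm N)\<^sup>2) \<longleftrightarrow> 0 < (fst g - fst l) \<bullet> N"
  proof
    assume "0 < (fst g - fst l) \<bullet> N"
    then show "\<exists>t>0. (fst g - fst l) \<bullet> N = t * (norm N)\<^sup>2"
      using n2 by (intro exI[of _ "((fst g - fst l) \<bullet> N) / (norm N)\<^sup>2"]) simp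
  qed (use n2 in auto)
  then show ?thesis
    using assms m0 m unfolding satisfies_def passes_right_def parallel_def N_def[symmetric] by auto
qed

text \<open>For parallel directions, moving the common point by \<open>snd l0\<close> gives a second
  common point.\<close>

lemma constraint_not_parallel:
  assumes "is_line l0" "constraint l0 g"
  shows "cross3 (snd g) (snd l0) \<noteq> 0"
proof
  assume z: "cross3 (snd g) (snd l0) = 0"
  obtain x where x: "on_line x l0" "on_line x g" "\<And>y. on_line y l0 \<Longrightarrow> on_line y g \<Longrightarrow> y = x"
    using assms(2) by (auto simp: constraint_def)
  have g: "snd g \<bullet> snd g \<noteq> 0" using assms(2) by (simp add: constraint_def is_line_def)
  define c where "c = (snd g \<bullet> snd l0) / (snd g \<bullet> snd g)"
  have "(snd g \<bullet> snd l0) *\<^sub>R snd g - (snd g \<bullet> snd g) *\<^sub>R snd l0 = 0"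
    using Lagrange[of "snd g" "snd g" "snd l0"] z by simp
  then have "(1 / (snd g \<bullet> snd g)) *\<^sub>R ((snd g \<bullet> snd g) *\<^sub>R snd l0) =
    (1 / (snd g \<bullet> snd g)) *\<^sub>R ((snd g \<bullet> snd l0) *\<^sub>R snd g)" by simp
  then have c: "snd l0 = c *\<^sub>R snd g" using g by (simp add: c_def)
  obtain s where "x = fst l0 + s *\<^sub>R snd l0" using x(1) by (auto simp: on_line_def)
  then have "on_line (x + snd l0) l0"
    unfolding on_line_def by (intro exI[of _ "s + 1"]) (simp add: scaleR_left_distrib add.assoc)
  moreover obtain r where "x = fst g + r *\<^sub>R snd g" using x(2) by (auto simp: on_line_def)
  then have "on_line (x + snd l0) g"
    unfolding on_line_def by (intro exI[of _ "r + c"]) (subst c, simp add: scaleR_left_distrib add.assoc)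
  ultimately have "x + snd l0 = x" by (rule x(3))
  then show False using assms(1) by (simp add: is_line_def)
qed

lemma exists_unimodular_completion:
  fixes d :: "real^3"
  assumes "d \<noteq> 0"
  obtains e1 e2 where "e1 \<bullet> cross3 e2 d = 1"
proof -
  obtain e where e: "e \<noteq> 0" "orthogonal d e" using orthogonal_to_vector_exists[of d] by auto
  have "(norm (cross3 e d))\<^sup>2 = (norm e * norm d)\<^sup>2"
    using norm_cross_dot[of e d] e(2) by (simp add: orthogonal_def inner_commute)
  then have N: "cross3 e d \<bullet> cross3 e d \<noteq> 0" using e(1) assms by auto
  then have "((1 / (cross3 e d \<bullet> cross3 e d)) *\<^sub>R cross3 e d) \<bullet> cross3 e d = 1" by simp
  then show ?thesis by (rule that)
qed

locale line_chart =
  fixes p0 d0 e1 e2 :: "real^3"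
  assumes unimodular: "e1 \<bullet> cross3 e2 d0 = 1"
begin

text \<open>Coordinates in the basis \<open>e1\<close>, \<open>e2\<close>, \<open>d0\<close> by
  Cramer's rule with denominator one; \<open>c3\<close> measures height along
  \<open>l0\<close>.\<close>

definition c1 :: "real^3 \<Rightarrow> real" where "c1 y = y \<bullet> cross3 e2 d0"
definition c2 :: "real^3 \<Rightarrow> real" where "c2 y = e1 \<bullet> cross3 y d0"
definition c3 :: "real^3 \<Rightarrow> real" where "c3 y = e1 \<bullet> cross3 e2 y"

lemma expansion: "y = c1 y *\<^sub>R e1 + c2 y *\<^sub>R e2 + c3 y *\<^sub>R d0"
  using cross3_Cramer[of e1 e2 d0 y] by (simp add: unimodular c1_def c2_def c3_def)

lemma coords_linear:
  "c1 (x + y) = c1 x + c1 y" "c1 (x - y) = c1 x - c1 y" "c1 (s *\<^sub>R x) = s * c1 x"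
  "c2 (x + y) = c2 x + c2 y" "c2 (x - y) = c2 x - c2 y" "c2 (s *\<^sub>R x) = s * c2 x"
  "c3 (x + y) = c3 x + c3 y" "c3 (x - y) = c3 x - c3 y" "c3 (s *\<^sub>R x) = s * c3 x"
  by (simp_all add: c1_def c2_def c3_def inner_add_left inner_diff_left inner_add_right inner_diff_right
      cross_add_left cross_add_right Cross3.left_diff_distrib Cross3.right_diff_distrib
      cross_mult_left cross_mult_right)

lemma coords_basis:
  "c1 e1 = 1" "c1 e2 = 0" "c1 d0 = 0" "c2 e1 = 0" "c2 e2 = 1" "c2 d0 = 0"
  "c3 e1 = 0" "c3 e2 = 0" "c3 d0 = 1"
  by (simp_all add: c1_def c2_def c3_def dot_cross_self unimodular)

lemma continuous_on_coords [continuous_intros]: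
  fixes f :: "'a::t2_space \<Rightarrow> real^3"
  assumes "continuous_on S f"
  shows "continuous_on S (\<lambda>x. c1 (f x))" "continuous_on S (\<lambda>x. c2 (f x))" "continuous_on S (\<lambda>x. c3 (f x))"
  unfolding c1_def c2_def c3_def
  by (intro continuous_on_inner continuous_on_const continuous_on_cross assms)+

lemma triple_product_coords:
  "x \<bullet> cross3 y z = c1 x * (c2 y * c3 z - c3 y * c2 z) - c2 x * (c1 y * c3 z - c3 y * c1 z)
     + c3 x * (c1 y * c2 z - c2 y * c1 z)"
proof -
  have perm: "e1 \<bullet> cross3 e2 d0 = 1" "e2 \<bullet> cross3 d0 e1 = 1" "d0 \<bullet> cross3 e1 e2 = 1"
    "e1 \<bullet> cross3 d0 e2 = - 1" "e2 \<bullet> cross3 e1 d0 = - 1" "d0 \<bullet> cross3 e2 e1 = - 1"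
    using unimodular by (simp_all add: cross3_simps)
  have "(x1 *\<^sub>R e1 + x2 *\<^sub>R e2 + x3 *\<^sub>R d0) \<bullet>
      cross3 (y1 *\<^sub>R e1 + y2 *\<^sub>R e2 + y3 *\<^sub>R d0) (z1 *\<^sub>R e1 + z2 *\<^sub>R e2 + z3 *\<^sub>R d0) =
    x1 * (y2 * z3 - y3 * z2) - x2 * (y1 * z3 - y3 * z1) + x3 * (y1 * z2 - y2 * z1)" for x1 x2 x3 y1 y2 y3 z1 z2 z3
    by (simp add: cross_add_left cross_add_right cross_mult_left cross_mult_right inner_add_left
        inner_add_right dot_cross_self perm algebra_simps)
  from this[of "c1 x" "c2 x" "c3 x" "c1 y" "c2 y" "c3 y" "c1 z" "c2 z" "c3 z"]
  show ?thesis by (simp flip: expansion)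
qed

definition chart_line :: "quad \<Rightarrow> oline" where
  "chart_line x = (p0 + fst (fst x) *\<^sub>R e1 + snd (fst x) *\<^sub>R e2, d0 + fst (snd x) *\<^sub>R e1 + snd (snd x) *\<^sub>R e2)"

text \<open>Junk if \<open>c3 (snd l) = 0\<close>, that is, if \<open>l\<close> is parallel to the plane spanned by \<open>e1\<close> and \<open>e2\<close>.\<close>

definition chart_point :: "oline \<Rightarrow> quad" where
  "chart_point l =
     ((c1 (fst l - p0) - c3 (fst l - p0) * (c1 (snd l) / c3 (snd l)),
       c2 (fst l - p0) - c3 (fst l - p0) * (c2 (snd l) / c3 (snd l))),
      (c1 (snd l) / c3 (snd l), c2 (snd l) / c3 (snd l)))"

text \<open>The linear part of the constraint at \<open>l0\<close>: the direction of
  \<open>g\<close> modulo \<open>d0\<close>, turned by a right angle, and \<open>h\<close> times the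
  same vector, where \<open>h\<close> is the height at which \<open>g\<close> meets
  \<open>l0\<close>.\<close>

definition covector :: "real \<Rightarrow> oline \<Rightarrow> quad" where
  "covector h g = ((- c2 (snd g), c1 (snd g)), h *\<^sub>R (- c2 (snd g), c1 (snd g)))"

lemma chart_point_chart_line: "chart_point (chart_line x) = x"
  by (simp add: chart_point_def chart_line_def coords_linear coords_basis)

lemma c3_chart_line: "c3 (snd (chart_line x)) = 1"
  by (simp add: chart_line_def coords_linear coords_basis)

lemma chart_line_0: "chart_line 0 = (p0, d0)"
  by (simp add: chart_line_def)

text \<open>Moving the base point of \<open>g\<close> to its common point with \<open>l0\<close>
  does not change the triple product. The rest is expansion in coordinates, with
  \<open>c3 (snd l)\<close> normalizing the direction of \<open>l\<close>.\<close>

lemma triple_product_chart_point: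
  assumes "p0 + h *\<^sub>R d0 = fst g + s *\<^sub>R snd g" "c3 (snd l) \<noteq> 0"
  shows "(fst g - fst l) \<bullet> cross3 (snd g) (snd l) =
    c3 (snd l) * (covector h g \<bullet> chart_point l + c3 (snd g) * klein_form (chart_point l))"
proof -
  define q where "q = fst l - p0"
  have "fst g - fst l = (h *\<^sub>R d0 - q) - s *\<^sub>R snd g"
    using assms(1) by (simp add: q_def algebra_simps)
  then have "(fst g - fst l) \<bullet> cross3 (snd g) (snd l) = (h *\<^sub>R d0 - q) \<bullet> cross3 (snd g) (snd l)"
    by (simp add: inner_diff_left[of "h *\<^sub>R d0 - q"] dot_cross_self)
  also have "\<dots> = - c1 q * (c2 (snd g) * c3 (snd l) - c3 (snd g) * c2 (snd l))
      + c2 q * (c1 (snd g) * c3 (snd l) - c3 (snd g) * c1 (snd l))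
      + (h - c3 q) * (c1 (snd g) * c2 (snd l) - c2 (snd g) * c1 (snd l))"
    unfolding triple_product_coords by (simp add: coords_linear coords_basis)
  also have "\<dots> = c3 (snd l) * (covector h g \<bullet> chart_point l + c3 (snd g) * klein_form (chart_point l))"
  proof -
    define k where "k = c3 (snd l)"
    define w1 where "w1 = c1 (snd l) / k"
    define w2 where "w2 = c2 (snd l) / k"
    have w: "c1 (snd l) = k * w1" "c2 (snd l) = k * w2" using assms(2) by (simp_all add: w1_def w2_def k_def)
    have cp: "chart_point l = ((c1 q - c3 q * w1, c2 q - c3 q * w2), (w1, w2))"
      by (simp add: chart_point_def q_def w1_def w2_def k_def)
    show ?thesis unfolding cp covector_def klein_form_def k_def[symmetric] w
      by (simp add: inner_prod_def algebra_simps)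
  qed
  finally show ?thesis .
qed

lemma same_oline_iff_chart_point:
  assumes "0 < c3 (snd l)"
  shows "same_oline (p0, d0) l \<longleftrightarrow> chart_point l = 0"
proof
  assume "same_oline (p0, d0) l"
  then obtain s c where "fst l = p0 + s *\<^sub>R d0" "snd l = c *\<^sub>R d0"
    by (auto simp: same_oline_def on_line_def)
  then show "chart_point l = 0"
    by (simp add: chart_point_def coords_linear coords_basis zero_prod_def)
next
  assume "chart_point l = 0"
  then have z: "c1 (snd l) = 0" "c2 (snd l) = 0" "c1 (fst l - p0) = 0" "c2 (fst l - p0) = 0"
    using assms by (auto simp: chart_point_def zero_prod_def)
  have "fst l - p0 = c3 (fst l - p0) *\<^sub>R d0" using expansion[of "fst l - p0"] z by simp
  then have "fst l = p0 + c3 (fst l - p0) *\<^sub>R d0" by (simp add: algebra_simps)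
  then have "on_line (fst l) (p0, d0)" unfolding on_line_def fst_conv snd_conv by blast
  moreover have "snd l = c3 (snd l) *\<^sub>R d0" using expansion[of "snd l"] z by simp
  ultimately show "same_oline (p0, d0) l" using assms unfolding same_oline_def snd_conv by blast
qed

text \<open>Near \<open>l0\<close> the triple product test is the chart inequality up to a positive
  factor. Neighborhoods are carried over by continuity of \<open>chart_line\<close> in one direction
  and of \<open>chart_point\<close> in the other.\<close>

lemma pins_iff_isolated_origin:
  assumes fin: "finite S" and np: "\<And>g. g \<in> S \<Longrightarrow> cross3 (snd g) d0 \<noteq> 0"
    and h: "\<And>g. g \<in> S \<Longrightarrow> \<exists>s. p0 + h g *\<^sub>R d0 = fst g + s *\<^sub>R snd g"
  shows "pins (p0, d0) S \<longleftrightarrow>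
    isolated_origin (\<lambda>g. covector (h g) g) (\<lambda>g. c3 (snd g)) klein_form S"
proof -
  \<comment> \<open>Positive \<open>c3\<close> fixes the orientation and makes
    \<open>chart_point\<close> meaningful; nonparallelism makes the triple product test available.
    Finiteness of \<open>S\<close> makes \<open>V\<close> open.\<close>
  define V :: "oline set" where "V = {l. 0 < c3 (snd l)} \<inter> (\<Inter>g\<in>S. {l. cross3 (snd g) (snd l) \<noteq> 0})"
  have "open {l :: oline. 0 < c3 (snd l)}" by (intro open_Collect_less continuous_intros)
  moreover have "open {l :: oline. cross3 (snd g) (snd l) \<noteq> 0}" for g :: oline
    by (intro open_Collect_neq continuous_on_cross continuous_intros)
  ultimately have openV: "open V" unfolding V_def using fin by (intro open_Int open_INT) auto
  have l0V: "(p0, d0) \<in> V" using np by (auto simp: V_def coords_basis)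
  have sat: "satisfies l g \<longleftrightarrow>
      0 \<le> covector (h g) g \<bullet> chart_point l + c3 (snd g) * klein_form (chart_point l)"
    if l: "l \<in> V" and g: "g \<in> S" for l g
  proof -
    have "0 < c3 (snd l)" "cross3 (snd g) (snd l) \<noteq> 0" using l g by (auto simp: V_def)
    moreover obtain s where "p0 + h g *\<^sub>R d0 = fst g + s *\<^sub>R snd g" using h[OF g] by blast
    ultimately show ?thesis
      using triple_product_chart_point[of "h g" g s l]
      by (simp add: satisfies_iff_triple_product zero_le_mult_iff)
  qed
  \<comment> \<open>The instance of linearity says \<open>c3 0 = 0\<close>, so lines in
    \<open>V\<close> have nonzero direction.\<close>
  have line: "is_line l" if "l \<in> V" for l
    using that coords_linear(9)[of 0 0] by (auto simp: V_def is_line_def)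
  show ?thesis
  proof
    assume "pins (p0, d0) S"
    then obtain U where U: "open U" "(p0, d0) \<in> U"
      "\<And>l. l \<in> U \<Longrightarrow> is_line l \<Longrightarrow> (\<And>g. g \<in> S \<Longrightarrow> satisfies l g) \<Longrightarrow> same_oline (p0, d0) l"
      unfolding pins_def by blast
    have "continuous_on UNIV chart_line" unfolding chart_line_def by (intro continuous_intros)
    then have "open (chart_line -` (U \<inter> V))" using U(1) openV by (intro open_vimage open_Int) auto
    moreover have "0 \<in> chart_line -` (U \<inter> V)" using U(2) l0V by (simp add: chart_line_0)
    ultimately obtain r where r: "r > 0" "ball 0 r \<subseteq> chart_line -` (U \<inter> V)"
      using open_contains_ball by blast
    show "isolated_origin (\<lambda>g. covector (h g) g) (\<lambda>g. c3 (snd g)) klein_form S"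
      unfolding isolated_origin_def
    proof (intro exI[of _ r] conjI allI impI r(1))
      fix x assume x: "norm x < r \<and> (\<forall>i\<in>S. 0 \<le> covector (h i) i \<bullet> x + c3 (snd i) * klein_form x)"
      then have inUV: "chart_line x \<in> U" "chart_line x \<in> V" using r(2) by auto
      have "same_oline (p0, d0) (chart_line x)"
        using x sat[OF inUV(2)] by (intro U(3) inUV line) (simp add: chart_point_chart_line)
      then show "x = 0"
        using same_oline_iff_chart_point[of "chart_line x"]
        by (simp add: c3_chart_line chart_point_chart_line)
    qed
  next
    assume "isolated_origin (\<lambda>g. covector (h g) g) (\<lambda>g. c3 (snd g)) klein_form S"
    then obtain r where r: "r > 0" "\<And>x. norm x < r \<Longrightarrow>
        (\<forall>i\<in>S. 0 \<le> covector (h i) i \<bullet> x + c3 (snd i) * klein_form x) \<Longrightarrow> x = 0"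
      unfolding isolated_origin_def by blast
    have "continuous_on V chart_point" unfolding chart_point_def
      by (intro continuous_intros) (auto simp: V_def)
    then have "open (V \<inter> chart_point -` ball 0 r)" by (rule continuous_open_preimage) (use openV in auto)
    moreover have "chart_point (p0, d0) = 0"
      using chart_point_chart_line[of 0] by (simp add: chart_line_0)
    then have "(p0, d0) \<in> V \<inter> chart_point -` ball 0 r" using r(1) l0V by simp
    moreover have "same_oline (p0, d0) l"
      if "l \<in> V \<inter> chart_point -` ball 0 r" "\<forall>g\<in>S. satisfies l g" for l
    proof -
      have "chart_point l = 0" using that sat by (intro r(2)) auto
      then show ?thesis using same_oline_iff_chart_point[of l] that(1) by (simp add: V_def)
    qed
    ultimately show "pins (p0, d0) S" unfolding pins_def by blast
  qed
qed

lemma covector_rank_one: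
  assumes "cross3 (snd g) d0 \<noteq> 0"
  shows "fst (covector h g) \<noteq> 0 \<and> (\<exists>\<mu>. snd (covector h g) = \<mu> *\<^sub>R fst (covector h g))"
proof -
  have "\<not> (c1 (snd g) = 0 \<and> c2 (snd g) = 0)"
  proof
    assume "c1 (snd g) = 0 \<and> c2 (snd g) = 0"
    then have "snd g = c3 (snd g) *\<^sub>R d0" using expansion[of "snd g"] by simp
    then have "cross3 (snd g) d0 = c3 (snd g) *\<^sub>R cross3 d0 d0" by (metis cross_mult_left)
    then show False using assms by simp
  qed
  then show ?thesis by (auto simp: covector_def zero_prod_def)
qed

text \<open>Proportional covectors force equal heights, hence a common point, and put
  \<open>snd g\<close> into the span of \<open>snd g'\<close> and \<open>d0\<close>; the common
  plane has normal \<open>n\<close>.\<close>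

lemma parallel_covectors_coplanar_concurrent:
  assumes np: "cross3 (snd g) d0 \<noteq> 0" "cross3 (snd g') d0 \<noteq> 0"
    and h: "p0 + h *\<^sub>R d0 = fst g + s *\<^sub>R snd g" "p0 + h' *\<^sub>R d0 = fst g' + s' *\<^sub>R snd g'"
    and par: "covector h g = c *\<^sub>R covector h' g'"
  shows "coplanar_concurrent (p0, d0) g g'"
proof -
  define n where "n = cross3 d0 (snd g')"
  have n: "n \<noteq> 0" using np(2) cross_skew[of d0 "snd g'"] by (simp add: n_def)
  have cc: "c1 (snd g) = c * c1 (snd g')" "c2 (snd g) = c * c2 (snd g')"
    "h * c1 (snd g) = h' * (c * c1 (snd g'))" "h * c2 (snd g) = h' * (c * c2 (snd g'))"
    using par by (auto simp: covector_def algebra_simps)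
  have "h = h'"
    using covector_rank_one[OF np(1), of 0] cc by (auto simp: covector_def zero_prod_def)
  define x where "x = p0 + h *\<^sub>R d0"
  have "c *\<^sub>R snd g' = c *\<^sub>R (c1 (snd g') *\<^sub>R e1 + c2 (snd g') *\<^sub>R e2 + c3 (snd g') *\<^sub>R d0)"
    by (rule arg_cong[OF expansion])
  also have "\<dots> = c1 (snd g) *\<^sub>R e1 + c2 (snd g) *\<^sub>R e2 + (c * c3 (snd g')) *\<^sub>R d0"
    unfolding cc by (simp add: scaleR_add_right)
  finally have cg': "c *\<^sub>R snd g' = \<dots>" .
  have "snd g = c1 (snd g) *\<^sub>R e1 + c2 (snd g) *\<^sub>R e2 + c3 (snd g) *\<^sub>R d0" by (rule expansion)
  also have "\<dots> = c *\<^sub>R snd g' + (c3 (snd g) - c * c3 (snd g')) *\<^sub>R d0"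
    unfolding cg' by (simp add: scaleR_left_diff_distrib)
  finally have "snd g = c *\<^sub>R snd g' + (c3 (snd g) - c * c3 (snd g')) *\<^sub>R d0" .
  then have gn: "snd g \<bullet> n = 0"
    by (metis (no_types) add.right_neutral dot_cross_self(1,2) inner_add_left inner_scaleR_left mult_zero_right n_def)
  have other: "snd g' \<bullet> n = 0" "d0 \<bullet> n = 0" by (simp_all add: n_def dot_cross_self)
  have "(y - x) \<bullet> n = 0" if y: "on_line y (p0, d0) \<or> on_line y g \<or> on_line y g'" for y
  proof -
    consider t where "y = p0 + t *\<^sub>R d0" | t where "y = fst g + t *\<^sub>R snd g" | t where "y = fst g' + t *\<^sub>R snd g'"
      using y by (auto simp: on_line_def)
    then show ?thesis
    proof cases
      case 1
      then have "y - x = (t - h) *\<^sub>R d0" by (simp add: x_def algebra_simps)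
      then show ?thesis using other by simp
    next
      case 2
      then have "y - x = (t - s) *\<^sub>R snd g" using h(1) by (simp add: x_def algebra_simps)
      then show ?thesis using gn by simp
    next
      case 3
      then have "y - x = (t - s') *\<^sub>R snd g'" using h(2) \<open>h = h'\<close> by (simp add: x_def algebra_simps)
      then show ?thesis using other by simp
    qed
  qed
  then have "coplanar3 (p0, d0) g g'" unfolding coplanar3_def using n by blast
  moreover have "on_line x (p0, d0)" by (auto simp: on_line_def x_def)
  moreover have "on_line x g" using h(1) by (auto simp: on_line_def x_def)
  moreover have "on_line x g'" using h(2) \<open>h = h'\<close> by (auto simp: on_line_def x_def)
  ultimately show ?thesis unfolding coplanar_concurrent_def by blast
qed

end

text \<open>The hypothesis on \<open>same_oline\<close> allows each line only one representative in
  \<open>F\<close>, so \<open>card F\<close> counts lines.\<close>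

theorem theorem2:
  fixes l0 :: oline and F :: "oline set"
  assumes "is_line l0"
    and "finite F"
    and "\<forall>g\<in>F. constraint l0 g"
    and "\<forall>g\<in>F. \<forall>h\<in>F. same_oline g h \<longrightarrow> g = h"
    and "minimal_pinning l0 F"
  shows "card F \<le> 8 \<and>
         ((\<forall>g\<in>F. \<forall>h\<in>F. g \<noteq> h \<longrightarrow> \<not> coplanar_concurrent l0 g h) \<longrightarrow> card F \<le> 6)"
proof -
  obtain p0 d0 where l0: "l0 = (p0, d0)" by fastforce
  obtain e1 e2 where "e1 \<bullet> cross3 e2 d0 = 1"
    by (rule exists_unimodular_completion[of d0]) (use assms(1) l0 in \<open>auto simp: is_line_def\<close>)
  then interpret line_chart p0 d0 e1 e2 by unfold_locales
  have np: "cross3 (snd g) d0 \<noteq> 0" if "g \<in> F" for g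
    using constraint_not_parallel[OF assms(1), of g] assms(3) that by (simp add: l0)
  have "\<exists>h s. p0 + h *\<^sub>R d0 = fst g + s *\<^sub>R snd g" if g: "g \<in> F" for g
  proof -
    obtain x where "on_line x l0" "on_line x g" using assms(3) g by (auto simp: constraint_def)
    then show ?thesis by (auto simp: on_line_def l0)
  qed
  then obtain h s where h: "\<And>g. g \<in> F \<Longrightarrow> p0 + h g *\<^sub>R d0 = fst g + s g *\<^sub>R snd g" by metis
  let ?f = "\<lambda>g. covector (h g) g"
  let ?iso = "isolated_origin ?f (\<lambda>g. c3 (snd g)) klein_form"
  have pins: "pins l0 S \<longleftrightarrow> ?iso S" if "S \<subseteq> F" for S
    unfolding l0 using that finite_subset[OF that assms(2)] np h by (intro pins_iff_isolated_origin) blast+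
  have rank: "fst (?f g) \<noteq> 0 \<and> (\<exists>\<mu>. snd (?f g) = \<mu> *\<^sub>R fst (?f g))" if "g \<in> F" for g
    using covector_rank_one[OF np[OF that]] .
  have iso: "?iso F" using assms(5) pins[of F] by (simp add: minimal_pinning_def)
  \<comment> \<open>By minimality a subfamily that still isolates the origin is all of
    \<open>F\<close>, so bounds for subfamilies become bounds for \<open>F\<close>.\<close>
  have whole: "J = F" if "J \<subseteq> F" "?iso J" for J
    using assms(5) that pins[OF that(1)] unfolding minimal_pinning_def by blast
  have "card F \<le> 8" using isolated_origin_reduction(1)[OF assms(2) rank iso] whole by blast
  moreover have "card F \<le> 6" if nc: "\<forall>g\<in>F. \<forall>h\<in>F. g \<noteq> h \<longrightarrow> \<not> coplanar_concurrent l0 g h"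
  proof -
    have "\<forall>i\<in>F. \<forall>j\<in>F. i \<noteq> j \<longrightarrow> (\<forall>c. ?f i \<noteq> c *\<^sub>R ?f j)"
      using parallel_covectors_coplanar_concurrent[OF np np h h] nc unfolding l0 by blast
    then show ?thesis using isolated_origin_reduction(2)[OF assms(2) rank iso] whole by blast
  qed
  ultimately show ?thesis by blast
qed

end
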